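(* For the logarithmic potential $V(x)=-\log x$, the one-centre problem $\ddot u=\nabla V(|u|)$, $(u(0),\dot u(0))=(q_0,p_0)\in(\mathbb R^2\setminus\{0\})\times\mathbb R^2$, is globally (that is, with $\bar R=+\infty$) strongly regularizable via smoothing of the potential.
   Context: For $\varepsilon>0$, $V_\varepsilon(x)=V(\sqrt{x^2+\varepsilon^2})=-\frac12\log(x^2+\varepsilon^2)$. Here $\nabla V(|u|)$ and $\nabla V_\varepsilon(|u|)$ denote gradients with respect to $u\in\mathbb R^2$. For $\nu=(q_0,p_0)$, $u_\nu$ is the classical solution of $\ddot u=\nabla V(|u|)$ and $u_{\varepsilon,\nu}$ the solution of $\ddot u=\nabla V_\varepsilon(|u|)$ with initial data $(u(0),\dot u(0))=\nu$. A collision is the configuration $u=0$. $S(V)$ is the set of $\nu=(q_0,p_0)$, $q_0\neq0$, whose solution $u_\nu$ reaches the origin at a finite time $T_0=T_0(\nu)>0$. The problem is globally strongly regularizable via smoothing of the potential if for every $\bar\nu\in S(V)$ there exists the limit $\lim_{(\varepsilon,\nu)\to(0,\bar\nu)}u_{\varepsilon,\nu}=u_0$ (the joint limit as $\varepsilon\to0^+$ and $\nu\to\bar\nu$ in $\mathbb R^2\times\mathbb R^2$, with no relation between $\varepsilon$ and $\nu$), and the flow $$\tilde u_\nu(t)=\begin{cases}u_\nu(t),&\nu\notin S(V)\\ u_0(t),&\nu\in S(V)\ \ (u_0\text{ being the limit path associated with }\bar\nu=\nu)\end{cases}$$ is continuous with respect to $\nu$. Both are understood pointwise in time: the limit $u_0(t)=\lim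 u_{\varepsilon,\nu}(t)$ is required for every $t\in[0,2T_0(\bar\nu)]$, and, for each fixed $t\ge0$, $\nu\mapsto\tilde u_\nu(t)$ is required to be continuous on the set of $\nu$ for which it is defined (for $\nu\in S(V)$: $t\in[0,2T_0(\nu)]$). *)

theory Defs
  imports "HOL-Analysis.Analysis"
begin

type_synonym plane = "real ^ 2"

(* u solves u'' = grad F (u) on the time set J with (u(0), u'(0)) = nu, staying in the domain D
   of F; v is the velocity. J is always an interval with left end 0, where the derivatives are
   one-sided. *)
definition solves ::
    "plane set \<Rightarrow> (plane \<Rightarrow> real) \<Rightarrow> plane \<times> plane \<Rightarrow> real set \<Rightarrow> (real \<Rightarrow> plane) \<Rightarrow> bool" where
  "solves D F \<nu> J u \<longleftrightarrow>
     (\<forall>t\<in>J. u t \<in> D) \<and>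
     (\<exists>v. u 0 = fst \<nu> \<and> v 0 = snd \<nu> \<and>
        (\<forall>t\<in>J. (u has_vector_derivative v t) (at t within J) \<and>
               (\<exists>g. GDERIV F (u t) :> g \<and> (v has_vector_derivative g) (at t within J))))"

definition exists_until ::
    "plane set \<Rightarrow> (plane \<Rightarrow> real) \<Rightarrow> plane \<times> plane \<Rightarrow> real \<Rightarrow> bool" where
  "exists_until D F \<nu> t \<longleftrightarrow> (\<exists>u. solves D F \<nu> {0..t} u)"

(* The value at time t of the solution; meaningful only under exists_until. *)
definition flow ::
    "plane set \<Rightarrow> (plane \<Rightarrow> real) \<Rightarrow> plane \<times> plane \<Rightarrow> real \<Rightarrow> plane" where
  "flow D F \<nu> t = (THE x. \<exists>u. solves D F \<nu> {0..t} u \<and> u t = x)"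

(* A potential V is a function on (0,\<infinity>); its values at arguments \<le> 0 are never used. *)

definition smoothed :: "(real \<Rightarrow> real) \<Rightarrow> real \<Rightarrow> real \<Rightarrow> real" where
  "smoothed V \<epsilon> x = V (sqrt (x\<^sup>2 + \<epsilon>\<^sup>2))"

abbreviation radial :: "(real \<Rightarrow> real) \<Rightarrow> plane \<Rightarrow> real" where
  "radial V \<equiv> (\<lambda>u. V (norm u))"

abbreviation classical_exists :: "(real \<Rightarrow> real) \<Rightarrow> plane \<times> plane \<Rightarrow> real \<Rightarrow> bool" where
  "classical_exists V \<equiv> exists_until (- {0}) (radial V)"

abbreviation classical_flow :: "(real \<Rightarrow> real) \<Rightarrow> plane \<times> plane \<Rightarrow> real \<Rightarrow> plane" where
  "classical_flow V \<equiv> flow (- {0}) (radial V)"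

abbreviation smoothed_exists ::
    "(real \<Rightarrow> real) \<Rightarrow> real \<Rightarrow> plane \<times> plane \<Rightarrow> real \<Rightarrow> bool" where
  "smoothed_exists V \<epsilon> \<equiv> exists_until UNIV (radial (smoothed V \<epsilon>))"

abbreviation smoothed_flow ::
    "(real \<Rightarrow> real) \<Rightarrow> real \<Rightarrow> plane \<times> plane \<Rightarrow> real \<Rightarrow> plane" where
  "smoothed_flow V \<epsilon> \<equiv> flow UNIV (radial (smoothed V \<epsilon>))"

definition collides_at :: "(real \<Rightarrow> real) \<Rightarrow> plane \<times> plane \<Rightarrow> real \<Rightarrow> bool" where
  "collides_at V \<nu> T \<longleftrightarrow> 0 < T \<and>
     (\<exists>u. solves (- {0}) (radial V) \<nu> {0..<T} u \<and> (u \<longlongrightarrow> 0) (at_left T))"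

definition collision_set :: "(real \<Rightarrow> real) \<Rightarrow> (plane \<times> plane) set" where
  "collision_set V = {\<nu>. fst \<nu> \<noteq> 0 \<and> (\<exists>T. collides_at V \<nu> T)}"

definition collision_time :: "(real \<Rightarrow> real) \<Rightarrow> plane \<times> plane \<Rightarrow> real" where
  "collision_time V \<nu> = (THE T. collides_at V \<nu> T)"

(* The joint limit \<epsilon> \<rightarrow> 0+, \<mu> \<rightarrow> \<nu>, with no relation between \<epsilon> and \<mu>; \<mu> = \<nu> is allowed. *)
definition joint_filter :: "plane \<times> plane \<Rightarrow> (real \<times> (plane \<times> plane)) filter" where
  "joint_filter \<nu> = at (0, \<nu>) within ({0<..} \<times> UNIV)"

definition limit_path :: "(real \<Rightarrow> real) \<Rightarrow> plane \<times> plane \<Rightarrow> real \<Rightarrow> plane" where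
  "limit_path V \<nu> t = Lim (joint_filter \<nu>) (\<lambda>(\<epsilon>, \<mu>). smoothed_flow V \<epsilon> \<mu> t)"

definition regularized_flow :: "(real \<Rightarrow> real) \<Rightarrow> plane \<times> plane \<Rightarrow> real \<Rightarrow> plane" where
  "regularized_flow V \<nu> t =
     (if \<nu> \<in> collision_set V then limit_path V \<nu> t else classical_flow V \<nu> t)"

definition regularized_domain :: "(real \<Rightarrow> real) \<Rightarrow> real \<Rightarrow> (plane \<times> plane) set" where
  "regularized_domain V t =
     {\<nu>. fst \<nu> \<noteq> 0 \<and>
         (if \<nu> \<in> collision_set V then t \<le> 2 * collision_time V \<nu> else classical_exists V \<nu> t)}"

(* Existence of the limit includes that the smoothed solutions exist up to time t for all (\<epsilon>, \<mu>)
   close to (0, \<nu>), so that the limit does not concern unspecified values of flow. *)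
definition globally_strongly_regularizable :: "(real \<Rightarrow> real) \<Rightarrow> bool" where
  "globally_strongly_regularizable V \<longleftrightarrow>
     (\<forall>\<nu>\<in>collision_set V. \<forall>t\<in>{0..2 * collision_time V \<nu>}.
        (\<forall>\<^sub>F (\<epsilon>, \<mu>) in joint_filter \<nu>. smoothed_exists V \<epsilon> \<mu> t) \<and>
        (\<exists>x. ((\<lambda>(\<epsilon>, \<mu>). smoothed_flow V \<epsilon> \<mu> t) \<longlongrightarrow> x) (joint_filter \<nu>))) \<and>
     (\<forall>t\<ge>0. continuous_on (regularized_domain V t) (\<lambda>\<nu>. regularized_flow V \<nu> t))"

end

(* A collision orbit has zero angular momentum, hence runs along a ray; its speed tends to infinity
   at the collision time T. Consider a smoothed orbit with small eps and nearby initial data. Just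
   before T it still has large speed, and soon afterwards it has a pericentre, at a time tau close
   to T, since |u|^2 is strictly convex while the speed is large. By uniqueness the orbit is
   symmetric under reflection in the pericentre axis a combined with time reversal about tau. The
   diagonal entry in direction a of the tensor v v + u u / (|u|^2 + eps^2) is monotone up to the
   pericentre and at most 1 there, so the velocity component along a stays bounded while the speed
   is large: a is almost orthogonal to the ray. Hence the orbit passes almost straight through the
   origin, and its position at time t > T tends to -u(2 T - t). No relation between eps and the
   initial data enters.

   Away from collisions, Gronwall's inequality gives the joint limit; continuity of the regularized
   flow then follows formally from the existence of the joint limit at every point. *)

theory Submission
  imports Defs
begin

section \<open>Global solutions of Lipschitz differential equations\<close>

text \<open>The obstacle is the collision itself: near the origin the Lipschitz bound for the
  softened force is of order \<open>1 / \<epsilon>\<^sup>2\<close>, so Gronwall compares smoothed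
  and classical orbits only up to a time before \<open>T\<close>. The reflection replaces any
  estimate across the collision: it carries information from before \<open>T\<close> to times after
  it, and no deflection angle is ever computed as a function of \<epsilon> and the angular momentum.
  The logarithm enters through a mismatch of sizes: \<open>|u|^2 / (|u|^2 + \<epsilon>^2)\<close> is
  at most 1 uniformly in \<epsilon>, while the speed at a collision is unbounded. The first fact
  bounds the velocity along the axis and makes \<open>|u|^2\<close> convex at high speed; the second
  turns the bounded component into a small angle. The end point \<open>t = 2 * T\<close> is
  delicate. Reflection reaches only twice the pericentre time, which may fall short of
  \<open>2 * T\<close>. There the state at an intermediate time is taken as new initial data, and
  ordinary stability covers the rest; for this reason limits of velocities are tracked along with
  positions.\<close>

lemma integral_has_vector_derivative_atLeast:
  fixes f :: "real \<Rightarrow> 'a::banach"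
  assumes "continuous_on {0..} f" "0 \<le> t"
  shows "((\<lambda>u. integral {0..u} f) has_vector_derivative f t) (at t within {0..})"
proof -
  have "((\<lambda>u. integral {0..u} f) has_vector_derivative f t) (at t within {0..t+1})"
    using assms by (intro integral_has_vector_derivative) (auto intro: continuous_on_subset)
  moreover have "at t within {0..t+1} = at t within {0..}"
    by (rule at_within_nhd[of t "{..<t+1}"]) auto
  ultimately show ?thesis by simp
qed

text \<open>Integrating \<open>exp (K * s)\<close> gains a factor \<open>1 / K\<close>. In the
  weighted norm this gain keeps the Picard iterates bounded and makes the iteration
  contract.\<close>

lemma norm_integral_exp_bound:
  fixes f :: "real \<Rightarrow> 'a::banach"
  assumes "continuous_on {0..} f" "0 < K" "0 \<le> t"
    and bnd: "\<And>s. 0 \<le> s \<Longrightarrow> norm (f s) \<le> C * exp (K * s)"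
  shows "exp (- (K * t)) * norm (integral {0..t} f) \<le> C / K"
proof -
  have "0 \<le> C" using order_trans[OF norm_ge_zero bnd[of 0]] by simp
  have "((\<lambda>s. C * exp (K * s)) has_integral (C * exp (K * t) / K - C * exp (K * 0) / K)) {0..t}"
    using assms by (intro fundamental_theorem_of_calculus)
      (auto intro!: derivative_eq_intros simp flip: has_real_derivative_iff_has_vector_derivative)
  then have *: "(\<lambda>s. C * exp (K * s)) integrable_on {0..t}"
      "integral {0..t} (\<lambda>s. C * exp (K * s)) = C * exp (K * t) / K - C / K"
    by (auto intro: has_integral_integrable dest: integral_unique simp del: integral_mult_right)
  have "norm (integral {0..t} f) \<le> integral {0..t} (\<lambda>s. C * exp (K * s))"
  proof (rule integral_norm_bound_integral)
    show "f integrable_on {0..t}"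
      by (rule integrable_continuous_real, rule continuous_on_subset[OF assms(1)]) simp
  qed (use bnd *(1) in auto)
  also have "\<dots> \<le> C / K * exp (K * t)" using * \<open>0 \<le> C\<close> \<open>0 < K\<close> by simp
  finally have "exp (- (K * t)) * norm (integral {0..t} f) \<le> exp (- (K * t)) * (C / K * exp (K * t))"
    by (intro mult_left_mono) auto
  also have "\<dots> = C / K" by (simp add: exp_minus field_simps)
  finally show ?thesis .
qed

text \<open>Picard iteration is a contraction on the whole half-line once curves are measured in the
  weighted norm \<open>sup exp (- K t) |z t|\<close> with \<open>K > L\<close>; the fixed point below is \<open>exp (- K t) z t\<close>.\<close>

lemma lipschitz_ode_global_solution:
  fixes F :: "'a::banach \<Rightarrow> 'a"
  assumes lip: "\<And>x y. norm (F x - F y) \<le> L * norm (x - y)"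
  shows "\<exists>z. z 0 = z0 \<and> (\<forall>t\<ge>0. (z has_vector_derivative F (z t)) (at t within {0..}))"
proof -
  \<comment> \<open>Any \<open>K\<close> above \<open>\<bar>L\<bar>\<close> brings the contraction
    ratio \<open>\<bar>L\<bar> / K\<close> below 1.\<close>
  define K where "K = \<bar>L\<bar> + 1"
  have K: "0 < K" "\<bar>L\<bar> < K" "\<bar>L\<bar> / K < 1" by (auto simp: K_def)
  have lip': "norm (F x - F y) \<le> \<bar>L\<bar> * norm (x - y)" for x y
    by (rule order_trans[OF lip]) (intro mult_right_mono; simp)
  have "\<bar>L\<bar>-lipschitz_on UNIV F"
    by (rule lipschitz_onI) (auto simp: dist_norm lip')
  then have contF: "continuous_on UNIV F" by (rule lipschitz_on_continuous_on)
  define h where "h \<phi> s = F (exp (K * s) *\<^sub>R apply_bcontfun \<phi> s)" for \<phi> :: "real \<Rightarrow>\<^sub>C 'a" and s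
  have cont_h: "continuous_on S (h \<phi>)" for S \<phi>
    unfolding h_def
    by (rule continuous_on_compose2[OF contF]) (auto intro!: continuous_intros)
  define G where "G \<phi> t = exp (- (K * t)) *\<^sub>R (z0 + integral {0..t} (h \<phi>))" for \<phi> t
  have der: "((\<lambda>t. z0 + integral {0..t} (h \<phi>)) has_vector_derivative h \<phi> t) (at t within {0..})"
    if "0 \<le> t" for \<phi> t
    using integral_has_vector_derivative_atLeast[OF cont_h that]
    by (auto intro!: derivative_eq_intros)
  have contI: "continuous_on {0..} (\<lambda>t. z0 + integral {0..t} (h \<phi>))" for \<phi>
    using der by (auto simp: continuous_on_eq_continuous_within intro: has_vector_derivative_continuous)
  have bound_G: "norm (G \<phi> t) \<le> norm z0 + (norm (F 0) + \<bar>L\<bar> * norm \<phi>) / K" if "0 \<le> t" for \<phi> t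
  proof -
    have "norm (h \<phi> s) \<le> (norm (F 0) + \<bar>L\<bar> * norm \<phi>) * exp (K * s)" if "0 \<le> s" for s
    proof -
      have "norm (h \<phi> s) \<le> norm (F 0) + \<bar>L\<bar> * (exp (K * s) * norm (apply_bcontfun \<phi> s))"
        using norm_triangle_sub[of "h \<phi> s" "F 0"] lip'[of "exp (K * s) *\<^sub>R apply_bcontfun \<phi> s" 0]
        by (simp add: h_def)
      also have "\<dots> \<le> norm (F 0) * exp (K * s) + \<bar>L\<bar> * (exp (K * s) * norm \<phi>)"
        using that K by (intro add_mono mult_left_mono norm_bounded) (auto simp: mult_le_cancel_left1)
      finally show ?thesis by (simp add: algebra_simps)
    qed
    from norm_integral_exp_bound[OF cont_h K(1) \<open>0 \<le> t\<close> this]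
    have *: "exp (- (K * t)) * norm (integral {0..t} (h \<phi>)) \<le> (norm (F 0) + \<bar>L\<bar> * norm \<phi>) / K" by simp
    have "norm (G \<phi> t) \<le> exp (- (K * t)) * norm z0 + exp (- (K * t)) * norm (integral {0..t} (h \<phi>))"
      unfolding G_def norm_scaleR abs_exp_cancel distrib_left[symmetric]
      by (intro mult_left_mono norm_triangle_ineq) simp
    moreover have "exp (- (K * t)) * norm z0 \<le> norm z0"
      using that K by (intro mult_left_le_one_le) auto
    ultimately show ?thesis using * by linarith
  qed
  \<comment> \<open>Bounded continuous functions live on the whole line, so the image is frozen at
    its value at 0 for negative times.\<close>
  define P where "P \<phi> = Bcontfun (\<lambda>t. G \<phi> (max 0 t))" for \<phi>
  have "continuous_on UNIV (\<lambda>t. G \<phi> (max 0 t))" for \<phi>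
    unfolding G_def
    by (intro continuous_intros continuous_on_compose2[OF contI]) auto
  then have mem: "(\<lambda>t. G \<phi> (max 0 t)) \<in> bcontfun" for \<phi>
    by (rule bcontfun_normI) (rule bound_G, simp)
  have P: "apply_bcontfun (P \<phi>) t = G \<phi> (max 0 t)" for \<phi> t
    unfolding P_def by (rule fun_cong[OF Bcontfun_inverse[OF mem]])
  have "dist (P \<phi>) (P \<psi>) \<le> \<bar>L\<bar> / K * dist \<phi> \<psi>" for \<phi> \<psi>
  proof (rule dist_bound)
    fix t :: real
    define r where "r = max 0 t"
    have r: "0 \<le> r" by (simp add: r_def)
    have int: "h \<xi> integrable_on {0..r}" for \<xi> using cont_h by (rule integrable_continuous_real)
    have bd: "norm (h \<phi> s - h \<psi> s) \<le> (\<bar>L\<bar> * dist \<phi> \<psi>) * exp (K * s)" for s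
    proof -
      have "norm (h \<phi> s - h \<psi> s) \<le> \<bar>L\<bar> * (exp (K * s) * dist (apply_bcontfun \<phi> s) (apply_bcontfun \<psi> s))"
        using lip'[of "exp (K * s) *\<^sub>R apply_bcontfun \<phi> s" "exp (K * s) *\<^sub>R apply_bcontfun \<psi> s"]
        by (simp add: h_def dist_norm flip: scaleR_diff_right)
      also have "\<dots> \<le> \<bar>L\<bar> * (exp (K * s) * dist \<phi> \<psi>)"
        by (intro mult_left_mono dist_bounded) auto
      finally show ?thesis by (simp add: algebra_simps)
    qed
    have "G \<phi> r - G \<psi> r = exp (- (K * r)) *\<^sub>R integral {0..r} (\<lambda>s. h \<phi> s - h \<psi> s)"
      unfolding G_def Henstock_Kurzweil_Integration.integral_diff[OF int int]
      by (simp add: scaleR_diff_right scaleR_add_right)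
    then have "dist (apply_bcontfun (P \<phi>) t) (apply_bcontfun (P \<psi>) t)
        = exp (- (K * r)) * norm (integral {0..r} (\<lambda>s. h \<phi> s - h \<psi> s))"
      by (simp only: P dist_norm r_def[symmetric] norm_scaleR abs_exp_cancel)
    also have "\<dots> \<le> (\<bar>L\<bar> * dist \<phi> \<psi>) / K"
      by (rule norm_integral_exp_bound[OF continuous_on_diff[OF cont_h cont_h] K(1) r bd])
    finally show "dist (apply_bcontfun (P \<phi>) t) (apply_bcontfun (P \<psi>) t) \<le> \<bar>L\<bar> / K * dist \<phi> \<psi>" by simp
  qed
  then have "\<forall>\<phi> \<psi>. dist (P \<phi>) (P \<psi>) \<le> \<bar>L\<bar> / K * dist \<phi> \<psi>" by blast
  moreover have "0 \<le> \<bar>L\<bar> / K" using K(1) by simp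
  ultimately have "\<exists>!\<phi>. P \<phi> = \<phi>" using K(3) by (intro banach_fix_type)
  then obtain \<phi> where fixp: "P \<phi> = \<phi>" by (elim ex1E)
  define z where "z = (\<lambda>t. z0 + integral {0..t} (h \<phi>))"
  have "(z has_vector_derivative F (z t)) (at t within {0..})" if "0 \<le> t" for t
  proof -
    have "apply_bcontfun \<phi> t = exp (- (K * t)) *\<^sub>R z t"
      using P[of \<phi> t] that by (simp only: fixp G_def z_def max_absorb2)
    then have "z t = exp (K * t) *\<^sub>R apply_bcontfun \<phi> t"
      by (simp only: scaleR_scaleR flip: exp_add) simp
    then show ?thesis using der[OF that, of \<phi>] by (simp only: h_def z_def)
  qed
  moreover have "z 0 = z0" by (simp add: z_def)
  ultimately show ?thesis by blast
qed

section \<open>Orbits of the smoothed logarithmic problem\<close>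

lemma has_real_derivative_inner:
  assumes "(f has_vector_derivative f') (at t within J)" "(g has_vector_derivative g') (at t within J)"
  shows "((\<lambda>t. f t \<bullet> g t) has_real_derivative f t \<bullet> g' + f' \<bullet> g t) (at t within J)"
  unfolding has_field_derivative_def
  by (rule has_derivative_eq_rhs[OF has_derivative_inner[OF assms[unfolded has_vector_derivative_def]]])
    (simp add: fun_eq_iff algebra_simps)

lemma has_real_derivative_nonneg_imp_le:
  fixes f :: "real \<Rightarrow> real"
  assumes "a \<le> b"
    and "\<And>t. t \<in> {a..b} \<Longrightarrow> (f has_real_derivative f' t) (at t within {a..b})"
    and "\<And>t. t \<in> {a..b} \<Longrightarrow> 0 \<le> f' t"
  shows "f a \<le> f b"
proof (cases "a = b")
  case False
  then have "a < b" using assms(1) by simp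
  then have "\<exists>x\<in>{a<..<b}. f b - f a = f' x * (b - a)"
    using assms(2) by (intro mvt_simple) (auto simp: has_field_derivative_def)
  then obtain x where "x \<in> {a<..<b}" "f b - f a = f' x * (b - a)" by blast
  moreover have "0 \<le> f' x * (b - a)" using assms(3)[of x] \<open>x \<in> _\<close> by simp
  ultimately show ?thesis by linarith
qed simp

lemma has_real_derivative_zero_imp_constant:
  fixes f :: "real \<Rightarrow> real"
  assumes "convex J" "\<And>t. t \<in> J \<Longrightarrow> (f has_real_derivative 0) (at t within J)" "s \<in> J" "t \<in> J"
  shows "f s = f t"
  using has_derivative_zero_constant[of J f] assms by (fastforce simp: has_field_derivative_def lambda_zero)

lemma gronwall_affine:
  fixes e :: "real \<Rightarrow> real"
  assumes "0 \<le> T" "0 \<le> K" "0 \<le> M"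
    and der: "\<And>t. t \<in> {0..T} \<Longrightarrow> (e has_real_derivative e' t) (at t within {0..T})"
    and le: "\<And>t. t \<in> {0..T} \<Longrightarrow> e' t \<le> K * e t + M"
  shows "e T \<le> (e 0 + M * T) * exp (K * T)"
proof -
  \<comment> \<open>Integrating factor: as \<open>exp (- K * t) \<le> 1\<close>, the inhomogeneity
    adds at most \<open>M\<close> to the slope of \<open>e t * exp (- K * t)\<close>, which
    \<open>M * t\<close> compensates.\<close>
  define f where "f t = M * t - e t * exp (- K * t)" for t
  have "f 0 \<le> f T"
  proof (rule has_real_derivative_nonneg_imp_le[OF \<open>0 \<le> T\<close>])
    fix t assume t: "t \<in> {0..T}"
    show "(f has_real_derivative (M - (e' t - K * e t) * exp (- K * t))) (at t within {0..T})"
      unfolding f_def by (rule derivative_eq_intros der t refl)+ (simp add: algebra_simps)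
    have "exp (- K * t) \<le> 1" using t \<open>0 \<le> K\<close> by simp
    then have "(e' t - K * e t) * exp (- K * t) \<le> M * 1"
      using le[OF t] \<open>0 \<le> M\<close> by (intro order_trans[OF mult_right_mono mult_left_mono]) auto
    then show "0 \<le> M - (e' t - K * e t) * exp (- K * t)" by simp
  qed
  then have "e T * exp (- K * T) \<le> e 0 + M * T" by (simp add: f_def)
  then show ?thesis by (simp add: exp_minus field_simps)
qed

text \<open>First-failure argument: at the first time where \<open>e\<close> reaches
  \<open>B\<close>, the weak bound holds up to and including that time by continuity, and
  \<open>step\<close> makes it strict. This closes the circle in the stability proof, where the
  Gronwall estimate presupposes that the orbits are close.\<close>

lemma continuous_bootstrap:
  fixes e :: "real \<Rightarrow> real"
  assumes cont: "continuous_on {a..b} e" and "t \<in> {a..b}"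
    and step: "\<And>s. s \<in> {a..b} \<Longrightarrow> (\<And>r. r \<in> {a..s} \<Longrightarrow> e r \<le> B) \<Longrightarrow> e s < B"
    and start: "e a < B"
  shows "e t < B"
proof (rule ccontr)
  assume neg: "\<not> e t < B"
  define A where "A = {s \<in> {a..b}. B \<le> e s}"
  have "closed A" unfolding A_def
    by (intro continuous_on_closed_Collect_le cont continuous_intros)
  moreover have "A \<noteq> {}" using neg \<open>t \<in> _\<close> by (auto simp: A_def)
  moreover have "bdd_below A" by (auto simp: A_def)
  ultimately have m: "Inf A \<in> A" by (intro closed_contains_Inf)
  then have mem: "Inf A \<in> {a..b}" "B \<le> e (Inf A)" by (auto simp: A_def)
  have lt: "e r < B" if "r \<in> {a..<Inf A}" for r
  proof (rule ccontr)
    assume "\<not> e r < B"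
    then have "r \<in> A" using that mem by (auto simp: A_def)
    then show False using cInf_lower[OF _ \<open>bdd_below A\<close>, of r] that by auto
  qed
  have "a < Inf A" using mem start by (cases "a = Inf A") auto
  have "e (Inf A) \<le> B"
  proof (rule tendsto_upperbound)
    show "(e \<longlongrightarrow> e (Inf A)) (at (Inf A) within {a..Inf A})"
      using cont mem by (meson atLeastatMost_subset_iff continuous_on continuous_on_subset order_refl atLeastAtMost_iff)
    show "\<forall>\<^sub>F r in at (Inf A) within {a..Inf A}. e r \<le> B"
      using lt by (force simp: eventually_at_filter intro: always_eventually)
    show "at (Inf A) within {a..Inf A} \<noteq> bot"
      using \<open>a < Inf A\<close> by (simp add: at_within_Icc_at_left)
  qed
  then have "e r \<le> B" if "r \<in> {a..Inf A}" for r
    using lt[of r] that by (cases "r = Inf A") auto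
  then show False using step[OF mem(1)] mem by force
qed

section \<open>The softened force, its orbits and their symmetries\<close>

definition log_force :: "real \<Rightarrow> 'a::real_inner \<Rightarrow> 'a" where
  "log_force \<epsilon> x = - (x /\<^sub>R (x \<bullet> x + \<epsilon>\<^sup>2))"

text \<open>The positivity condition is automatic for nonzero \<epsilon> and excludes the origin for
  \<open>\<epsilon> = 0\<close>, so classical and smoothed orbits share one notion. The velocity is
  explicit because estimates and uniqueness live in phase space.\<close>

definition log_orbit :: "real \<Rightarrow> real set \<Rightarrow> (real \<Rightarrow> 'a::real_inner) \<Rightarrow> (real \<Rightarrow> 'a) \<Rightarrow> bool" where
  "log_orbit \<epsilon> J u v \<longleftrightarrow> (\<forall>t\<in>J. 0 < u t \<bullet> u t + \<epsilon>\<^sup>2 \<and>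
     (u has_vector_derivative v t) (at t within J) \<and>
     (v has_vector_derivative log_force \<epsilon> (u t)) (at t within J))"

lemma log_orbitD:
  assumes "log_orbit \<epsilon> J u v" "t \<in> J"
  shows "0 < u t \<bullet> u t + \<epsilon>\<^sup>2"
    "(u has_vector_derivative v t) (at t within J)"
    "(v has_vector_derivative log_force \<epsilon> (u t)) (at t within J)"
  using assms by (auto simp: log_orbit_def)

lemma log_orbit_subset: "log_orbit \<epsilon> J u v \<Longrightarrow> I \<subseteq> J \<Longrightarrow> log_orbit \<epsilon> I u v"
  unfolding log_orbit_def by (blast intro: has_vector_derivative_within_subset)

lemma log_orbit_continuous:
  assumes "log_orbit \<epsilon> J u v"
  shows "continuous_on J u" "continuous_on J v"
  using log_orbitD[OF assms]
  by (auto simp: continuous_on_eq_continuous_within intro: has_vector_derivative_continuous)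

lemma log_orbit_shift:
  assumes "log_orbit \<epsilon> J u v" "\<And>t. t \<in> I \<Longrightarrow> c + t \<in> J"
  shows "log_orbit \<epsilon> I (\<lambda>t. u (c + t)) (\<lambda>t. v (c + t))"
  unfolding log_orbit_def
proof (intro ballI conjI)
  fix t assume t: "t \<in> I"
  have d: "((\<lambda>t. c + t) has_vector_derivative 1) (at t within I)"
    by (auto intro!: derivative_eq_intros)
  have im: "(\<lambda>t. c + t) ` I \<subseteq> J" using assms(2) by auto
  note o = log_orbitD[OF assms(1) assms(2)[OF t]]
  show "0 < u (c + t) \<bullet> u (c + t) + \<epsilon>\<^sup>2" by (rule o)
  show "((\<lambda>t. u (c + t)) has_vector_derivative v (c + t)) (at t within I)"
    using vector_diff_chain_within[OF d has_vector_derivative_within_subset[OF o(2) im]] by (simp add: o_def)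
  show "((\<lambda>t. v (c + t)) has_vector_derivative log_force \<epsilon> (u (c + t))) (at t within I)"
    using vector_diff_chain_within[OF d has_vector_derivative_within_subset[OF o(3) im]] by (simp add: o_def)
qed

lemma log_orbit_reverse:
  assumes "log_orbit \<epsilon> J u v" "\<And>t. t \<in> I \<Longrightarrow> c - t \<in> J"
  shows "log_orbit \<epsilon> I (\<lambda>t. u (c - t)) (\<lambda>t. - v (c - t))"
  unfolding log_orbit_def
proof (intro ballI conjI)
  fix t assume t: "t \<in> I"
  have d: "((\<lambda>t. c - t) has_vector_derivative - 1) (at t within I)"
    by (auto intro!: derivative_eq_intros)
  have im: "(\<lambda>t. c - t) ` I \<subseteq> J" using assms(2) by auto
  note o = log_orbitD[OF assms(1) assms(2)[OF t]]
  show "0 < u (c - t) \<bullet> u (c - t) + \<epsilon>\<^sup>2" by (rule o)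
  show "((\<lambda>t. u (c - t)) has_vector_derivative - v (c - t)) (at t within I)"
    using vector_diff_chain_within[OF d has_vector_derivative_within_subset[OF o(2) im]] by (simp add: o_def)
  show "((\<lambda>t. - v (c - t)) has_vector_derivative log_force \<epsilon> (u (c - t))) (at t within I)"
    using has_vector_derivative_minus[OF vector_diff_chain_within[OF d has_vector_derivative_within_subset[OF o(3) im]]]
    by (simp add: o_def)
qed

lemma log_orbit_isometry:
  assumes orb: "log_orbit \<epsilon> J u v" and lin: "bounded_linear R"
    and iso: "\<And>x. R x \<bullet> R x = x \<bullet> x"
  shows "log_orbit \<epsilon> J (\<lambda>t. R (u t)) (\<lambda>t. R (v t))"
  unfolding log_orbit_def
proof (intro ballI conjI)
  fix t assume t: "t \<in> J"
  note o = log_orbitD[OF orb t]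
  interpret R: bounded_linear R by (rule lin)
  show "0 < R (u t) \<bullet> R (u t) + \<epsilon>\<^sup>2" using o by (simp add: iso)
  show "((\<lambda>t. R (u t)) has_vector_derivative R (v t)) (at t within J)"
    by (rule R.has_vector_derivative o)+
  have "R (log_force \<epsilon> (u t)) = log_force \<epsilon> (R (u t))"
    by (simp add: log_force_def iso R.scaleR linear_neg[OF bounded_linear.linear[OF lin]])
  then show "((\<lambda>t. R (v t)) has_vector_derivative log_force \<epsilon> (R (u t))) (at t within J)"
    using R.has_vector_derivative[OF o(3)] by simp
qed

section \<open>Dependence on the parameter and the initial data\<close>

lemma log_force_diff_le:
  fixes x y :: "'a::real_inner"
  assumes "0 < c" "c\<^sup>2 \<le> x \<bullet> x + \<delta>\<^sup>2" "c\<^sup>2 \<le> y \<bullet> y + \<epsilon>\<^sup>2"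
  shows "norm (log_force \<delta> x - log_force \<epsilon> y) \<le> 3 / c\<^sup>2 * norm (x - y) + \<bar>\<epsilon>\<^sup>2 - \<delta>\<^sup>2\<bar> / c ^ 3"
proof -
  define A B where "A = x \<bullet> x + \<delta>\<^sup>2" and "B = y \<bullet> y + \<epsilon>\<^sup>2"
  have AB: "c\<^sup>2 \<le> A" "c\<^sup>2 \<le> B" using assms by (auto simp: A_def B_def)
  have pos: "0 < A" "0 < B" using AB assms(1) by (auto intro: less_le_trans[of _ "c\<^sup>2"])
  define d m where "d = norm (x - y)" and "m = \<bar>\<epsilon>\<^sup>2 - \<delta>\<^sup>2\<bar>"
  have dm: "0 \<le> d" "0 \<le> m" by (auto simp: d_def m_def)
  have xA: "norm x \<le> sqrt A" and yB: "norm y \<le> sqrt B"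
    by (auto simp: A_def B_def norm_eq_sqrt_inner)
  have cA: "c \<le> sqrt A" "c \<le> sqrt B" using AB assms(1) by (auto intro: real_le_rsqrt)
  have "\<bar>B - A\<bar> \<le> m + d * (norm x + norm y)"
  proof -
    have "B - A = (\<epsilon>\<^sup>2 - \<delta>\<^sup>2) - (x - y) \<bullet> (x + y)"
      by (simp add: A_def B_def algebra_simps inner_commute)
    then have "\<bar>B - A\<bar> \<le> m + \<bar>(x - y) \<bullet> (x + y)\<bar>" by (simp add: m_def)
    also have "\<bar>(x - y) \<bullet> (x + y)\<bar> \<le> d * norm (x + y)" unfolding d_def by (rule Cauchy_Schwarz_ineq2)
    also have "\<dots> \<le> d * (norm x + norm y)" by (intro mult_left_mono norm_triangle_ineq dm)
    finally show ?thesis by simp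
  qed
  also have "\<dots> \<le> m + d * (sqrt A + sqrt B)" using xA yB dm by (intro add_mono mult_left_mono) auto
  finally have BA: "\<bar>B - A\<bar> \<le> m + d * (sqrt A + sqrt B)" .
  have "log_force \<delta> x - log_force \<epsilon> y = - ((x - y) /\<^sub>R A + ((B - A) / (A * B)) *\<^sub>R y)"
  proof -
    have "inverse A - inverse B = (B - A) / (A * B)" using pos by (simp add: field_simps)
    then have "((B - A) / (A * B)) *\<^sub>R y = y /\<^sub>R A - y /\<^sub>R B" by (metis scaleR_left_diff_distrib)
    then show ?thesis by (simp add: log_force_def A_def[symmetric] B_def[symmetric] scaleR_diff_right)
  qed
  then have "norm (log_force \<delta> x - log_force \<epsilon> y) = norm ((x - y) /\<^sub>R A + ((B - A) / (A * B)) *\<^sub>R y)"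
    by (simp only: norm_minus_cancel)
  also have "\<dots> \<le> d / A + \<bar>B - A\<bar> / (A * B) * norm y"
  proof (rule norm_triangle_le)
    have "norm ((x - y) /\<^sub>R A) = d / A"
      using pos by (simp only: norm_scaleR d_def) (simp add: divide_inverse mult.commute)
    moreover have "norm (((B - A) / (A * B)) *\<^sub>R y) = \<bar>B - A\<bar> / (A * B) * norm y"
      using pos by (simp only: norm_scaleR abs_divide abs_mult abs_of_pos)
    ultimately show "norm ((x - y) /\<^sub>R A) + norm (((B - A) / (A * B)) *\<^sub>R y) \<le> d / A + \<bar>B - A\<bar> / (A * B) * norm y"
      by linarith
  qed
  also have "\<dots> \<le> d / A + (m + d * (sqrt A + sqrt B)) / (A * B) * sqrt B"
    using BA yB pos dm by (intro add_left_mono mult_mono divide_right_mono) auto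
  \<comment> \<open>The factor \<open>sqrt B\<close> that bounds \<open>norm y\<close> cancels
    against the denominator. Three terms in \<open>d\<close>, each at most
    \<open>d / c\<^sup>2\<close>, remain; they give the constant 3.\<close>
  also have "\<dots> = 2 * (d * inverse (sqrt A * sqrt A)) + d * inverse (sqrt A * sqrt B)
      + m * inverse (sqrt A * sqrt A * sqrt B)"
  proof -
    define a b where "a = sqrt A" and "b = sqrt B"
    have ab: "A = a * a" "B = b * b" "a \<noteq> 0" "b \<noteq> 0" using pos by (auto simp: a_def b_def)
    have "d / (a * a) + (m + d * (a + b)) / (a * a * (b * b)) * b =
        2 * (d * inverse (a * a)) + d * inverse (a * b) + m * inverse (a * a * b)"
    proof -
      have "a * inverse a = 1" "b * inverse b = 1" using ab(3,4) by simp_all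
      then show ?thesis unfolding divide_inverse inverse_mult_distrib by algebra
    qed
    then show ?thesis unfolding a_def[symmetric] b_def[symmetric] unfolding ab(1,2) .
  qed
  also have "\<dots> \<le> 2 * (d * inverse (c * c)) + d * inverse (c * c) + m * inverse (c * c * c)"
  proof -
    have "c * c \<le> sqrt A * sqrt A" "c * c \<le> sqrt A * sqrt B"
      using mult_mono[OF cA(1) cA(1)] mult_mono[OF cA(1) cA(2)] assms(1) pos by simp_all
    moreover from this(1) have "c * c * c \<le> sqrt A * sqrt A * sqrt B"
      using assms(1) pos by (intro mult_mono[OF _ cA(2)]) simp_all
    ultimately show ?thesis
      using assms(1) by (intro add_mono mult_left_mono le_imp_inverse_le dm) simp_all
  qed
  also have "\<dots> = 3 / c\<^sup>2 * d + m / c ^ 3"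
    by (simp add: divide_inverse power2_eq_square power3_eq_cube algebra_simps)
  finally show ?thesis by (simp add: d_def m_def)
qed

text \<open>Gronwall for the squared phase-space distance. In the rate
  \<open>2 + 3 / c\<^sup>2\<close>, one unit comes from the product of position and velocity
  differences, one from splitting off the parameter mismatch by
  \<open>2 * a * b \<le> a\<^sup>2 + b\<^sup>2\<close>, and the rest is the Lipschitz constant of
  the force at softened distance at least \<open>c\<close>.\<close>

lemma log_orbit_compare:
  assumes "log_orbit \<epsilon> {0..T} u v" "log_orbit \<delta> {0..T} u' v'" "0 < c" "0 \<le> T"
    and "\<And>t. t \<in> {0..T} \<Longrightarrow> c\<^sup>2 \<le> u t \<bullet> u t + \<epsilon>\<^sup>2"
    and "\<And>t. t \<in> {0..T} \<Longrightarrow> c\<^sup>2 \<le> u' t \<bullet> u' t + \<delta>\<^sup>2"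
  shows "(norm (u' T - u T))\<^sup>2 + (norm (v' T - v T))\<^sup>2
    \<le> ((norm (u' 0 - u 0))\<^sup>2 + (norm (v' 0 - v 0))\<^sup>2 + (\<bar>\<epsilon>\<^sup>2 - \<delta>\<^sup>2\<bar> / c ^ 3)\<^sup>2 * T) * exp ((2 + 3 / c\<^sup>2) * T)"
proof -
  define m where "m = \<bar>\<epsilon>\<^sup>2 - \<delta>\<^sup>2\<bar> / c ^ 3"
  define x y where "x t = u' t - u t" and "y t = v' t - v t" for t
  define e where "e t = (norm (x t))\<^sup>2 + (norm (y t))\<^sup>2" for t
  define f where "f t = log_force \<delta> (u' t) - log_force \<epsilon> (u t)" for t
  have "e T \<le> (e 0 + m\<^sup>2 * T) * exp ((2 + 3 / c\<^sup>2) * T)"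
  proof (rule gronwall_affine[OF \<open>0 \<le> T\<close>])
    fix t assume t: "t \<in> {0..T}"
    note o = log_orbitD[OF assms(1) t] and o' = log_orbitD[OF assms(2) t]
    have dx: "(x has_vector_derivative y t) (at t within {0..T})"
      unfolding x_def y_def by (rule has_vector_derivative_diff o o')+
    have dy: "(y has_vector_derivative f t) (at t within {0..T})"
      unfolding f_def y_def by (rule has_vector_derivative_diff o o')+
    show "(e has_real_derivative 2 * (x t \<bullet> y t) + 2 * (y t \<bullet> f t)) (at t within {0..T})"
      using DERIV_add[OF has_real_derivative_inner[OF dx dx] has_real_derivative_inner[OF dy dy]]
      by (simp add: e_def[abs_def] power2_norm_eq_inner inner_commute)
    have "norm (f t) \<le> 3 / c\<^sup>2 * norm (x t) + m"
      using log_force_diff_le[OF \<open>0 < c\<close> assms(6)[OF t] assms(5)[OF t]] by (simp add: f_def x_def m_def)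
    then have "y t \<bullet> f t \<le> norm (y t) * (3 / c\<^sup>2 * norm (x t) + m)"
      by (intro order_trans[OF norm_cauchy_schwarz] mult_left_mono) auto
    also have "\<dots> = 3 / c\<^sup>2 * (norm (x t) * norm (y t)) + norm (y t) * m" by (simp add: algebra_simps)
    finally have "2 * (y t \<bullet> f t) \<le> 3 / c\<^sup>2 * (2 * norm (x t) * norm (y t)) + 2 * norm (y t) * m" by simp
    also have "\<dots> \<le> 3 / c\<^sup>2 * e t + ((norm (y t))\<^sup>2 + m\<^sup>2)"
      unfolding e_def by (intro add_mono mult_left_mono sum_squares_bound) auto
    finally have 1: "2 * (y t \<bullet> f t) \<le> 3 / c\<^sup>2 * e t + ((norm (y t))\<^sup>2 + m\<^sup>2)" .
    have 2: "2 * (x t \<bullet> y t) \<le> e t"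
      using norm_cauchy_schwarz[of "x t" "y t"] sum_squares_bound[of "norm (x t)" "norm (y t)"]
      by (simp add: e_def)
    have "(norm (y t))\<^sup>2 \<le> e t" by (simp add: e_def)
    with 1 2 show "2 * (x t \<bullet> y t) + 2 * (y t \<bullet> f t) \<le> (2 + 3 / c\<^sup>2) * e t + m\<^sup>2"
      by (simp add: algebra_simps)
  qed auto
  then show ?thesis by (simp add: e_def x_def y_def m_def)
qed

lemma log_orbit_lower_bound:
  assumes "log_orbit \<epsilon> {0..T} u v"
  obtains c where "0 < c" "\<And>t. t \<in> {0..T} \<Longrightarrow> c\<^sup>2 \<le> u t \<bullet> u t + \<epsilon>\<^sup>2"
proof (cases "0 \<le> T")
  case True
  have "continuous_on {0..T} (\<lambda>t. u t \<bullet> u t + \<epsilon>\<^sup>2)"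
    by (intro continuous_intros log_orbit_continuous[OF assms])
  then obtain s where s: "s \<in> {0..T}" "\<And>t. t \<in> {0..T} \<Longrightarrow> u s \<bullet> u s + \<epsilon>\<^sup>2 \<le> u t \<bullet> u t + \<epsilon>\<^sup>2"
    using continuous_attains_inf[of "{0..T}" "\<lambda>t. u t \<bullet> u t + \<epsilon>\<^sup>2"] True by auto
  have "0 < u s \<bullet> u s + \<epsilon>\<^sup>2" using log_orbitD[OF assms s(1)] by simp
  then show thesis using s by (intro that[of "sqrt (u s \<bullet> u s + \<epsilon>\<^sup>2)"]) auto
qed (auto intro: that[of 1])

lemma log_orbit_unique:
  assumes "log_orbit \<epsilon> {0..T} u v" "log_orbit \<epsilon> {0..T} u' v'" "u' 0 = u 0" "v' 0 = v 0" "t \<in> {0..T}"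
  shows "u' t = u t \<and> v' t = v t"
proof -
  have o: "log_orbit \<epsilon> {0..t} u v" "log_orbit \<epsilon> {0..t} u' v'"
    using assms by (auto intro: log_orbit_subset)
  obtain c where c: "0 < c" "\<And>s. s \<in> {0..t} \<Longrightarrow> c\<^sup>2 \<le> u s \<bullet> u s + \<epsilon>\<^sup>2" by (rule log_orbit_lower_bound[OF o(1)]) blast
  obtain d where d: "0 < d" "\<And>s. s \<in> {0..t} \<Longrightarrow> d\<^sup>2 \<le> u' s \<bullet> u' s + \<epsilon>\<^sup>2" by (rule log_orbit_lower_bound[OF o(2)]) blast
  have "(min c d)\<^sup>2 \<le> c\<^sup>2" "(min c d)\<^sup>2 \<le> d\<^sup>2" using c(1) d(1) by (auto intro!: power_mono)
  then have "(min c d)\<^sup>2 \<le> u s \<bullet> u s + \<epsilon>\<^sup>2" "(min c d)\<^sup>2 \<le> u' s \<bullet> u' s + \<epsilon>\<^sup>2" if "s \<in> {0..t}" for s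
    using c(2)[OF that] d(2)[OF that] by linarith+
  from log_orbit_compare[OF o _ _ this]
  have "(norm (u' t - u t))\<^sup>2 + (norm (v' t - v t))\<^sup>2 \<le> 0"
    using c(1) d(1) assms(3-5) by simp
  then show ?thesis by (simp add: sum_power2_le_zero_iff)
qed

text \<open>The softened distance is at least \<epsilon> everywhere, so the first-order vector field
  is globally Lipschitz.\<close>

lemma log_orbit_exists:
  fixes \<mu> :: "'a::{real_inner,banach} \<times> 'a"
  assumes "0 < \<epsilon>"
  shows "\<exists>u v. log_orbit \<epsilon> {0..} u v \<and> u 0 = fst \<mu> \<and> v 0 = snd \<mu>"
proof -
  define F :: "'a \<times> 'a \<Rightarrow> 'a \<times> 'a" where "F z = (snd z, log_force \<epsilon> (fst z))" for z
  have "norm (F z - F w) \<le> (1 + 3 / \<epsilon>\<^sup>2) * norm (z - w)" for z w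
  proof -
    have "norm (log_force \<epsilon> (fst z) - log_force \<epsilon> (fst w)) \<le> 3 / \<epsilon>\<^sup>2 * norm (fst z - fst w)"
      using log_force_diff_le[of \<epsilon> "fst z" \<epsilon> "fst w" \<epsilon>] assms by simp
    also have "\<dots> \<le> 3 / \<epsilon>\<^sup>2 * norm (z - w)"
      by (intro mult_left_mono) (metis fst_diff norm_fst_le prod.collapse, simp)
    finally have "norm (log_force \<epsilon> (fst z) - log_force \<epsilon> (fst w)) \<le> 3 / \<epsilon>\<^sup>2 * norm (z - w)" .
    moreover have "norm (snd z - snd w) \<le> norm (z - w)"
      by (metis snd_diff norm_snd_le prod.collapse)
    moreover have "norm (F z - F w) \<le> norm (snd z - snd w) + norm (log_force \<epsilon> (fst z) - log_force \<epsilon> (fst w))"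
      using norm_Pair_le[of "snd z - snd w" "log_force \<epsilon> (fst z) - log_force \<epsilon> (fst w)"] by (simp add: F_def)
    ultimately show ?thesis by (simp add: algebra_simps)
  qed
  from lipschitz_ode_global_solution[of F, OF this, of \<mu>]
  obtain z where z: "z 0 = \<mu>" "\<And>t. 0 \<le> t \<Longrightarrow> (z has_vector_derivative F (z t)) (at t within {0..})"
    by blast
  have "log_orbit \<epsilon> {0..} (\<lambda>t. fst (z t)) (\<lambda>t. snd (z t))"
    unfolding log_orbit_def
  proof (intro ballI conjI)
    fix t :: real assume "t \<in> {0..}"
    then have d: "(z has_vector_derivative F (z t)) (at t within {0..})" using z by simp
    show "0 < fst (z t) \<bullet> fst (z t) + \<epsilon>\<^sup>2" using assms by (simp add: add_nonneg_pos)
    show "((\<lambda>t. fst (z t)) has_vector_derivative snd (z t)) (at t within {0..})"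
      using bounded_linear.has_vector_derivative[OF bounded_linear_fst d] by (simp add: F_def)
    show "((\<lambda>t. snd (z t)) has_vector_derivative log_force \<epsilon> (fst (z t))) (at t within {0..})"
      using bounded_linear.has_vector_derivative[OF bounded_linear_snd d] by (simp add: F_def)
  qed
  then show ?thesis using z(1) by (intro exI[of _ "\<lambda>t. fst (z t)"] exI[of _ "\<lambda>t. snd (z t)"]) simp
qed

text \<open>On a compact interval the classical orbit keeps a distance \<open>c\<close> from the
  origin, so an orbit within \<open>c / 2\<close> of it keeps the distance \<open>c / 2\<close>.
  There the Gronwall rate does not depend on \<epsilon>.\<close>

lemma log_orbit_uniform_stability:
  assumes orb: "log_orbit 0 {0..T} u v" and "0 \<le> T" "0 < \<eta>"
  shows "\<exists>d>0. \<forall>\<epsilon> U W. \<bar>\<epsilon>\<bar> < d \<longrightarrow> log_orbit \<epsilon> {0..T} U W \<longrightarrow> dist (U 0) (u 0) < d \<longrightarrow> dist (W 0) (v 0) < d \<longrightarrow>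
    (\<forall>t\<in>{0..T}. dist (U t) (u t) < \<eta> \<and> dist (W t) (v t) < \<eta>)"
proof -
  obtain c where c: "0 < c" "\<And>t. t \<in> {0..T} \<Longrightarrow> c\<^sup>2 \<le> u t \<bullet> u t + 0\<^sup>2"
    by (rule log_orbit_lower_bound[OF orb]) blast
  define \<rho> where "\<rho> = c / 2"
  \<comment> \<open>At most \<eta> for the conclusion, at most \<rho> to keep the perturbed orbit
    away from the origin.\<close>
  define B where "B = min \<eta> \<rho>"
  define K where "K = 2 + 3 / \<rho>\<^sup>2"
  have pos: "0 < \<rho>" "0 < B" "0 < K" using c \<open>0 < \<eta>\<close> by (auto simp: \<rho>_def B_def K_def add_pos_nonneg)
  \<comment> \<open>The Gronwall bound with both initial errors and the size of \<epsilon> replaced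
    by \<open>d\<close>; it tends to 0 with \<open>d\<close>.\<close>
  define b where "b d = (d\<^sup>2 + d\<^sup>2 + (d\<^sup>2 / \<rho> ^ 3)\<^sup>2 * T) * exp (K * T)" for d :: real
  have "(b \<longlongrightarrow> 0) (at_right 0)"
    unfolding b_def using pos by (auto intro!: tendsto_eq_intros)
  then have "\<forall>\<^sub>F d in at_right 0. b d < B\<^sup>2"
    using pos by (intro order_tendstoD(2)) auto
  moreover have "\<forall>\<^sub>F d in at_right 0. (0::real) < d" by (simp add: eventually_at_right_less)
  ultimately have "\<forall>\<^sub>F d in at_right 0. 0 < d \<and> b d < B\<^sup>2" by eventually_elim simp
  then obtain d where d: "0 < d" "b d < B\<^sup>2"
    using eventually_happens[of _ "at_right (0::real)"] by auto
  have "dist (U t) (u t) < \<eta> \<and> dist (W t) (v t) < \<eta>"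
    if \<epsilon>: "\<bar>\<epsilon>\<bar> < d" and o: "log_orbit \<epsilon> {0..T} U W" and init: "dist (U 0) (u 0) < d" "dist (W 0) (v 0) < d"
      and t: "t \<in> {0..T}" for \<epsilon> U W t
  proof -
    define e where "e t = (norm (U t - u t))\<^sup>2 + (norm (W t - v t))\<^sup>2" for t
    have e0: "e 0 \<le> d\<^sup>2 + d\<^sup>2"
      unfolding e_def using init by (intro add_mono power_mono) (auto simp: dist_norm)
    have "e 0 * 1 \<le> b d"
      unfolding b_def using \<open>0 \<le> T\<close> pos by (intro mult_mono order_trans[OF e0]) (auto simp: e_def)
    then have start: "e 0 < B\<^sup>2" using d by simp
    have cont: "continuous_on {0..T} e"
      unfolding e_def by (intro continuous_intros log_orbit_continuous[OF o] log_orbit_continuous[OF orb])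
    have step: "e s < B\<^sup>2" if s: "s \<in> {0..T}" and le: "\<And>r. r \<in> {0..s} \<Longrightarrow> e r \<le> B\<^sup>2" for s
    proof -
      have low: "\<rho>\<^sup>2 \<le> U r \<bullet> U r + \<epsilon>\<^sup>2 \<and> \<rho>\<^sup>2 \<le> u r \<bullet> u r + 0\<^sup>2" if "r \<in> {0..s}" for r
      proof -
        have "(norm (U r - u r))\<^sup>2 \<le> B\<^sup>2"
          using le[OF that] zero_le_power2[of "norm (W r - v r)"] unfolding e_def by linarith
        then have "norm (U r - u r) \<le> \<rho>" using pos by (auto simp: B_def dest: power2_le_imp_le)
        moreover have "2 * \<rho> \<le> norm (u r)"
          using c(2)[of r] that s by (auto simp: \<rho>_def norm_eq_sqrt_inner intro: real_le_rsqrt)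
        ultimately have "\<rho> \<le> norm (U r)" "\<rho> \<le> norm (u r)"
          using norm_triangle_ineq2[of "u r" "U r"] pos by (auto simp: norm_minus_commute)
        then have "\<rho>\<^sup>2 \<le> (norm (U r))\<^sup>2" "\<rho>\<^sup>2 \<le> (norm (u r))\<^sup>2" using pos by (auto intro: power_mono)
        then show ?thesis by (simp add: power2_norm_eq_inner add_increasing2)
      qed
      have "{0..s} \<subseteq> {0..T}" using s by auto
      then have "e s \<le> (e 0 + (\<bar>0\<^sup>2 - \<epsilon>\<^sup>2\<bar> / \<rho> ^ 3)\<^sup>2 * s) * exp (K * s)"
        unfolding e_def K_def using s low pos
        by (intro log_orbit_compare log_orbit_subset[OF o] log_orbit_subset[OF orb]) auto
      also have "\<dots> \<le> b d"
      proof -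
        have "\<epsilon>\<^sup>2 \<le> d\<^sup>2" using \<epsilon> by (simp add: abs_le_square_iff[symmetric])
        then have "(\<bar>0\<^sup>2 - \<epsilon>\<^sup>2\<bar> / \<rho> ^ 3)\<^sup>2 \<le> (d\<^sup>2 / \<rho> ^ 3)\<^sup>2"
          using pos by (intro power_mono divide_right_mono) auto
        then show ?thesis unfolding b_def using s pos e0
          by (intro mult_mono add_mono) (auto intro!: add_nonneg_nonneg)
      qed
      finally show ?thesis using d(2) by linarith
    qed
    have "e t < B\<^sup>2" by (rule continuous_bootstrap[OF cont t step start])
    then have "(norm (U t - u t))\<^sup>2 < B\<^sup>2" "(norm (W t - v t))\<^sup>2 < B\<^sup>2"
      using zero_le_power2[of "norm (W t - v t)"] zero_le_power2[of "norm (U t - u t)"]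
      unfolding e_def by linarith+
    then have "norm (U t - u t) < B" "norm (W t - v t) < B"
      using pos by (auto intro: power2_less_imp_less)
    then show ?thesis by (auto simp: B_def dist_norm)
  qed
  then show ?thesis using d(1) by blast
qed

section \<open>Conserved quantities, symmetry and pericentres\<close>

lemma log_orbit_derivatives:
  assumes "log_orbit \<epsilon> J u v" "t \<in> J"
  shows "((\<lambda>t. u t \<bullet> u t) has_real_derivative 2 * (u t \<bullet> v t)) (at t within J)"
    "((\<lambda>t. v t \<bullet> v t) has_real_derivative - 2 * (u t \<bullet> v t) / (u t \<bullet> u t + \<epsilon>\<^sup>2)) (at t within J)"
    "((\<lambda>t. u t \<bullet> v t) has_real_derivative v t \<bullet> v t - (u t \<bullet> u t) / (u t \<bullet> u t + \<epsilon>\<^sup>2)) (at t within J)"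
  using has_real_derivative_inner[OF log_orbitD(2)[OF assms] log_orbitD(2)[OF assms]]
    has_real_derivative_inner[OF log_orbitD(3)[OF assms] log_orbitD(3)[OF assms]]
    has_real_derivative_inner[OF log_orbitD(2)[OF assms] log_orbitD(3)[OF assms]]
  by (simp_all add: log_force_def inner_commute divide_inverse algebra_simps)

text \<open>The conserved sum is twice the mechanical energy.\<close>

lemma log_orbit_energy:
  assumes "log_orbit \<epsilon> J u v" "convex J" "s \<in> J" "t \<in> J"
  shows "v s \<bullet> v s + ln (u s \<bullet> u s + \<epsilon>\<^sup>2) = v t \<bullet> v t + ln (u t \<bullet> u t + \<epsilon>\<^sup>2)"
proof (rule has_real_derivative_zero_imp_constant[OF assms(2) _ assms(3,4)])
  fix t assume t: "t \<in> J"
  show "((\<lambda>t. v t \<bullet> v t + ln (u t \<bullet> u t + \<epsilon>\<^sup>2)) has_real_derivative 0) (at t within J)"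
    using log_orbitD(1)[OF assms(1) t]
    by (auto intro!: derivative_eq_intros log_orbit_derivatives[OF assms(1) t] simp: divide_inverse)
qed

text \<open>By Lagrange's identity this is the squared angular momentum, written with inner products
  so that no dimension is fixed.\<close>

lemma log_orbit_angular_momentum:
  assumes "log_orbit \<epsilon> J u v" "convex J" "s \<in> J" "t \<in> J"
  shows "(u s \<bullet> u s) * (v s \<bullet> v s) - (u s \<bullet> v s)\<^sup>2 = (u t \<bullet> u t) * (v t \<bullet> v t) - (u t \<bullet> v t)\<^sup>2"
proof (rule has_real_derivative_zero_imp_constant[OF assms(2) _ assms(3,4)])
  fix t assume t: "t \<in> J"
  show "((\<lambda>t. (u t \<bullet> u t) * (v t \<bullet> v t) - (u t \<bullet> v t)\<^sup>2) has_real_derivative 0) (at t within J)"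
    by (auto intro!: derivative_eq_intros log_orbit_derivatives[OF assms(1) t] simp: divide_inverse algebra_simps)
qed

text \<open>For a unit vector \<open>a\<close> this map fixes the line spanned by \<open>a\<close>
  and negates its orthogonal complement.\<close>

definition axis_reflection :: "'a::real_inner \<Rightarrow> 'a \<Rightarrow> 'a" where
  "axis_reflection a x = (2 * (a \<bullet> x)) *\<^sub>R a - x"

lemma bounded_linear_axis_reflection: "bounded_linear (axis_reflection a)"
  unfolding axis_reflection_def[abs_def]
  by (intro bounded_linear_sub bounded_linear_ident bounded_linear_scaleR_const
      bounded_linear_const_mult bounded_linear_inner_right)

lemma axis_reflection_isometry:
  "norm a = 1 \<Longrightarrow> axis_reflection a x \<bullet> axis_reflection a x = x \<bullet> x"
  by (simp add: axis_reflection_def norm_eq_1 algebra_simps inner_commute)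

lemma log_orbit_axis_symmetry:
  assumes orb: "log_orbit \<epsilon> {0..2 * \<tau>} u v" and "norm a = 1" "u \<tau> = (a \<bullet> u \<tau>) *\<^sub>R a" "a \<bullet> v \<tau> = 0"
    and s: "s \<in> {0..\<tau>}"
  shows "u (\<tau> + s) = axis_reflection a (u (\<tau> - s))" "v (\<tau> + s) = - axis_reflection a (v (\<tau> - s))"
proof -
  interpret R: bounded_linear "axis_reflection a" by (rule bounded_linear_axis_reflection)
  have 1: "log_orbit \<epsilon> {0..\<tau>} (\<lambda>s. u (\<tau> + s)) (\<lambda>s. v (\<tau> + s))"
    by (rule log_orbit_shift[OF orb]) auto
  have "log_orbit \<epsilon> {0..\<tau>} (\<lambda>s. u (\<tau> - s)) (\<lambda>s. - v (\<tau> - s))"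
    by (rule log_orbit_reverse[OF orb]) auto
  from log_orbit_isometry[OF this bounded_linear_axis_reflection axis_reflection_isometry[OF assms(2)]]
  have 2: "log_orbit \<epsilon> {0..\<tau>} (\<lambda>s. axis_reflection a (u (\<tau> - s))) (\<lambda>s. axis_reflection a (- v (\<tau> - s)))" .
  \<comment> \<open>The position lies on the axis; time reversal negates the velocity and the
    reflection negates it back. So both curves leave \<tau> from the same state.\<close>
  have "axis_reflection a (u \<tau>) = u \<tau>"
    using assms(3) by (simp add: axis_reflection_def scaleR_2 flip: scaleR_scaleR)
  moreover have "axis_reflection a (- v \<tau>) = v \<tau>"
    using assms(4) by (simp add: axis_reflection_def)
  ultimately have "axis_reflection a (u (\<tau> - s)) = u (\<tau> + s) \<and> axis_reflection a (- v (\<tau> - s)) = v (\<tau> + s)"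
    using log_orbit_unique[OF 1 2 _ _ s] by simp
  then show "u (\<tau> + s) = axis_reflection a (u (\<tau> - s))" "v (\<tau> + s) = - axis_reflection a (v (\<tau> - s))"
    by (simp_all add: linear_neg[OF R.linear, symmetric])
qed

text \<open>The Fradkin-type tensor \<open>v \<otimes> v + k u \<otimes> u\<close> with \<open>k = 1 / (|u|\<^sup>2 + \<epsilon>\<^sup>2)\<close> has derivative
  \<open>k' u \<otimes> u\<close>, so along an inward arc its diagonal entry in direction \<open>a\<close> is at most its value at
  the pericentre, which is at most 1 when \<open>a\<close> is normal to the velocity there.\<close>

lemma log_orbit_transverse_velocity:
  assumes orb: "log_orbit \<epsilon> {s..\<tau>} u v" and "s \<le> \<tau>" "norm a = 1" "a \<bullet> v \<tau> = 0"
    and inw: "\<And>t. t \<in> {s..\<tau>} \<Longrightarrow> u t \<bullet> v t \<le> 0"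
  shows "\<bar>a \<bullet> v s\<bar> \<le> 1"
proof -
  define g where "g t = (a \<bullet> v t)\<^sup>2 + (a \<bullet> u t)\<^sup>2 / (u t \<bullet> u t + \<epsilon>\<^sup>2)" for t
  have "g s \<le> g \<tau>"
  proof (rule has_real_derivative_nonneg_imp_le[OF assms(2)])
    fix t assume t: "t \<in> {s..\<tau>}"
    note o = log_orbitD[OF orb t]
    have da: "((\<lambda>t. a \<bullet> u t) has_real_derivative a \<bullet> v t) (at t within {s..\<tau>})"
      "((\<lambda>t. a \<bullet> v t) has_real_derivative - (a \<bullet> u t) / (u t \<bullet> u t + \<epsilon>\<^sup>2)) (at t within {s..\<tau>})"
      using has_real_derivative_inner[OF has_vector_derivative_const[of a] o(2)]
        has_real_derivative_inner[OF has_vector_derivative_const[of a] o(3)]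
      by (simp_all add: log_force_def divide_inverse mult.commute)
    show "(g has_real_derivative (a \<bullet> u t)\<^sup>2 * (- 2 * (u t \<bullet> v t)) / (u t \<bullet> u t + \<epsilon>\<^sup>2)\<^sup>2) (at t within {s..\<tau>})"
    proof -
      define N where "N = u t \<bullet> u t + \<epsilon>\<^sup>2"
      have "N \<noteq> 0" using o(1) by (simp add: N_def)
      show ?thesis
        unfolding g_def[abs_def]
        by (rule DERIV_cong[OF DERIV_add[OF DERIV_power[OF da(2), of 2] DERIV_divide[OF DERIV_power[OF da(1), of 2]
              DERIV_add[OF log_orbit_derivatives(1)[OF orb t] DERIV_const]]]])
          (simp_all only: N_def[symmetric], use \<open>N \<noteq> 0\<close> in \<open>simp_all add: field_simps power2_eq_square\<close>)
    qed
    show "0 \<le> (a \<bullet> u t)\<^sup>2 * (- 2 * (u t \<bullet> v t)) / (u t \<bullet> u t + \<epsilon>\<^sup>2)\<^sup>2"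
      using inw[OF t] by (simp add: mult_nonneg_nonpos divide_nonpos_nonneg)
  qed
  moreover have "g \<tau> \<le> 1"
  proof -
    have "(a \<bullet> u \<tau>)\<^sup>2 \<le> u \<tau> \<bullet> u \<tau>"
      using Cauchy_Schwarz_ineq[of a "u \<tau>"] assms(3) by (simp add: norm_eq_1)
    also have "\<dots> \<le> u \<tau> \<bullet> u \<tau> + \<epsilon>\<^sup>2" by simp
    finally show ?thesis using log_orbitD(1)[OF orb, of \<tau>] assms(2,4) by (simp add: g_def)
  qed
  moreover have "(a \<bullet> v s)\<^sup>2 \<le> g s"
    using log_orbitD(1)[OF orb, of s] assms(2) by (simp add: g_def)
  ultimately have "(a \<bullet> v s)\<^sup>2 \<le> 1" by linarith
  then show ?thesis by (simp add: abs_square_le_1)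
qed

lemma log_orbit_inward_norm_le:
  assumes orb: "log_orbit \<epsilon> {s..t} u v" and "s \<le> t" "\<And>r. r \<in> {s..t} \<Longrightarrow> u r \<bullet> v r \<le> 0"
  shows "norm (u t) \<le> norm (u s)"
proof -
  have "- (u s \<bullet> u s) \<le> - (u t \<bullet> u t)"
    using assms by (intro has_real_derivative_nonneg_imp_le[OF assms(2), where f' = "\<lambda>r. - (2 * (u r \<bullet> v r))"]
        DERIV_minus log_orbit_derivatives[OF orb]) auto
  then show ?thesis by (simp add: norm_eq_sqrt_inner)
qed

text \<open>During inward motion the speed does not decrease, so the derivative of
  \<open>u \<bullet> v\<close>, which is the squared speed minus a quantity at most 1, is at least 2
  - 1. Hence \<open>u \<bullet> v\<close> climbs from its negative start to 0 within time
  \<open>- (u s \<bullet> v s)\<close>. Taking the first zero makes the whole arc before it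
  inward.\<close>

lemma log_orbit_pericentre:
  assumes orb: "log_orbit \<epsilon> {s..s + \<delta>} u v" and "0 \<le> \<delta>"
    and inw: "u s \<bullet> v s < 0" and le: "- (u s \<bullet> v s) \<le> \<delta>" and fast: "2 \<le> v s \<bullet> v s"
  obtains \<tau> where "\<tau> \<in> {s..s + \<delta>}" "u \<tau> \<bullet> v \<tau> = 0" "\<And>t. t \<in> {s..\<tau>} \<Longrightarrow> u t \<bullet> v t \<le> 0"
proof -
  define w where "w t = u t \<bullet> v t" for t
  have cont: "continuous_on {s..s + \<delta>} w"
    unfolding w_def[abs_def] by (intro continuous_intros log_orbit_continuous[OF orb])
  have neg: "w t < 0" if t: "t \<in> {s..s + \<delta>}" and nz: "\<And>r. r \<in> {s..t} \<Longrightarrow> w r \<noteq> 0" for t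
  proof (rule ccontr)
    assume "\<not> w t < 0"
    moreover have "continuous_on {s..t} w" by (rule continuous_on_subset[OF cont]) (use t in auto)
    ultimately obtain r where "s \<le> r" "r \<le> t" "w r = 0"
      using IVT'[of w s 0 t] inw t by (auto simp: w_def)
    then show False using nz[of r] by auto
  qed
  define Z where "Z = {t \<in> {s..s + \<delta>}. w t = 0}"
  have "Z \<noteq> {}"
  proof
    assume empty: "Z = {}"
    have lt: "w t < 0" if "t \<in> {s..s + \<delta>}" for t
      by (rule neg[OF that]) (use that empty in \<open>auto simp: Z_def\<close>)
    have fast': "2 \<le> v t \<bullet> v t" if t: "t \<in> {s..s + \<delta>}" for t
    proof -
      have o: "log_orbit \<epsilon> {s..t} u v" by (rule log_orbit_subset[OF orb]) (use t in auto)
      have "v s \<bullet> v s \<le> v t \<bullet> v t"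
      proof (rule has_real_derivative_nonneg_imp_le[where f = "\<lambda>t. v t \<bullet> v t"])
        fix r assume r: "r \<in> {s..t}"
        show "((\<lambda>t. v t \<bullet> v t) has_real_derivative - 2 * (u r \<bullet> v r) / (u r \<bullet> u r + \<epsilon>\<^sup>2)) (at r within {s..t})"
          by (rule log_orbit_derivatives[OF o r])
        show "0 \<le> - 2 * (u r \<bullet> v r) / (u r \<bullet> u r + \<epsilon>\<^sup>2)"
          using lt[of r] r t log_orbitD(1)[OF o r] by (intro divide_nonneg_pos) (auto simp: w_def)
      qed (use t in auto)
      then show ?thesis using fast by simp
    qed
    have "w s - s \<le> w (s + \<delta>) - (s + \<delta>)"
    proof (rule has_real_derivative_nonneg_imp_le[where f = "\<lambda>t. w t - t"])
      fix t assume t: "t \<in> {s..s + \<delta>}"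
      show "((\<lambda>t. w t - t) has_real_derivative v t \<bullet> v t - (u t \<bullet> u t) / (u t \<bullet> u t + \<epsilon>\<^sup>2) - 1) (at t within {s..s + \<delta>})"
        unfolding w_def by (intro DERIV_diff log_orbit_derivatives[OF orb t] DERIV_ident)
      have "(u t \<bullet> u t) / (u t \<bullet> u t + \<epsilon>\<^sup>2) \<le> 1" using log_orbitD(1)[OF orb t] by simp
      then show "0 \<le> v t \<bullet> v t - (u t \<bullet> u t) / (u t \<bullet> u t + \<epsilon>\<^sup>2) - 1" using fast'[OF t] by simp
    qed (use \<open>0 \<le> \<delta>\<close> in auto)
    then show False using le lt[of "s + \<delta>"] \<open>0 \<le> \<delta>\<close> by (simp add: w_def)
  qed
  moreover have "closed Z" unfolding Z_def
    by (intro continuous_closed_preimage_constant cont closed_atLeastAtMost)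
  moreover have bdd: "bdd_below Z" by (auto simp: Z_def)
  ultimately have "Inf Z \<in> Z" by (intro closed_contains_Inf)
  then have mem: "Inf Z \<in> {s..s + \<delta>}" "w (Inf Z) = 0" by (auto simp: Z_def)
  show thesis
  proof (rule that[OF mem(1)])
    show "u (Inf Z) \<bullet> v (Inf Z) = 0" using mem by (simp add: w_def)
    fix t assume t: "t \<in> {s..Inf Z}"
    show "u t \<bullet> v t \<le> 0"
    proof (cases "t = Inf Z")
      case False
      have "w r \<noteq> 0" if "r \<in> {s..t}" for r
        using cInf_lower[OF _ bdd, of r] that t mem False by (auto simp: Z_def)
      then show ?thesis using neg[of t] t mem by (simp add: w_def)
    qed (use mem in \<open>simp add: w_def\<close>)
  qed
qed

section \<open>Collision orbits\<close>

text \<open>By energy conservation \<open>v \<bullet> v\<close> is a constant minus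
  \<open>ln (u \<bullet> u)\<close>, so with \<open>x = u \<bullet> u\<close> this limit says that
  the speed diverges too slowly to compete with the vanishing distance.\<close>

lemma tendsto_mult_ln_at_right_0: "((\<lambda>x::real. x * (C - ln x)) \<longlongrightarrow> 0) (at_right 0)"
proof -
  have "((\<lambda>x::real. ln (inverse x) / inverse x) \<longlongrightarrow> 0) (at_right 0)"
    by (rule filterlim_compose[OF ln_x_over_x_tendsto_0 filterlim_inverse_at_top_right])
  then have "((\<lambda>x::real. x * C + ln (inverse x) / inverse x) \<longlongrightarrow> 0 * C + 0) (at_right 0)"
    by (intro tendsto_intros)
  moreover have "\<forall>\<^sub>F x in at_right 0. x * C + ln (inverse x) / inverse x = x * (C - ln x)"
    by (rule eventually_at_rightI[of 0 1]) (auto simp: ln_inverse divide_inverse algebra_simps)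
  ultimately have "((\<lambda>x. x * (C - ln x)) \<longlongrightarrow> 0 * C + 0) (at_right 0)"
    by (rule Lim_transform_eventually)
  then show ?thesis by simp
qed

lemma axis_reflection_eq_self_iff: "axis_reflection a x = x \<longleftrightarrow> x = (a \<bullet> x) *\<^sub>R a"
proof -
  have "axis_reflection a x - x = 2 *\<^sub>R ((a \<bullet> x) *\<^sub>R a - x)"
    by (simp add: axis_reflection_def scaleR_diff_right scaleR_2[of x])
  then have "axis_reflection a x - x = 0 \<longleftrightarrow> (a \<bullet> x) *\<^sub>R a - x = 0" by simp
  then show ?thesis unfolding right_minus_eq by metis
qed

lemma inner_close:
  fixes x y x' y' :: "'b::real_inner"
  assumes "norm (x' - x) \<le> \<theta>" "norm (y' - y) \<le> \<theta>" "norm x \<le> M" "norm y \<le> M" "\<theta> \<le> 1"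
  shows "\<bar>x' \<bullet> y' - x \<bullet> y\<bar> \<le> \<theta> * (2 * M + 1)"
proof -
  have "0 \<le> \<theta>" using assms(1) norm_ge_zero order_trans by blast
  have "norm y' \<le> M + 1" using norm_triangle_sub[of y' y] assms by linarith
  have "x' \<bullet> y' - x \<bullet> y = (x' - x) \<bullet> y' + x \<bullet> (y' - y)" by (simp add: inner_diff)
  then have "\<bar>x' \<bullet> y' - x \<bullet> y\<bar> \<le> \<bar>(x' - x) \<bullet> y'\<bar> + \<bar>x \<bullet> (y' - y)\<bar>" by linarith
  also have "\<dots> \<le> norm (x' - x) * norm y' + norm x * norm (y' - y)"
    by (intro add_mono Cauchy_Schwarz_ineq2)
  also have "\<dots> \<le> \<theta> * (M + 1) + M * \<theta>"
    using assms \<open>norm y' \<le> M + 1\<close> \<open>0 \<le> \<theta>\<close> by (intro add_mono mult_mono) (auto intro: order_trans[OF norm_ge_zero])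
  finally show ?thesis by (simp add: algebra_simps)
qed

text \<open>The ambient space is an arbitrary real inner product space; the plane enters later only
  through the existence of unit vectors orthogonal to a given one.\<close>

locale log_collision =
  fixes u v :: "real \<Rightarrow> 'a::real_inner" and T :: real
  assumes T: "0 < T" and orb: "log_orbit 0 {0..<T} u v" and lim: "(u \<longlongrightarrow> 0) (at_left T)"
begin

lemma near_T: "\<forall>\<^sub>F t in at_left T. t \<in> {0..<T}"
  using eventually_at_left_real[OF T] by eventually_elim auto

lemma tendsto_uu: "((\<lambda>t. u t \<bullet> u t) \<longlongrightarrow> 0) (at_left T)"
  using tendsto_inner[OF lim lim] by simp

lemma filterlim_uu: "filterlim (\<lambda>t. u t \<bullet> u t) (at_right 0) (at_left T)"
  unfolding filterlim_at
proof (intro conjI tendsto_uu)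
  show "\<forall>\<^sub>F t in at_left T. u t \<bullet> u t \<in> {0<..} \<and> u t \<bullet> u t \<noteq> 0"
    using near_T by eventually_elim (use log_orbitD(1)[OF orb] in auto)
qed

lemma vv_eq: "t \<in> {0..<T} \<Longrightarrow> v t \<bullet> v t = (v 0 \<bullet> v 0 + ln (u 0 \<bullet> u 0)) - ln (u t \<bullet> u t)"
  using log_orbit_energy[OF orb convex_real_interval(7), of 0 t] T by (simp add: eq_diff_eq)

lemma filterlim_vv: "filterlim (\<lambda>t. v t \<bullet> v t) at_top (at_left T)"
proof -
  have "filterlim (\<lambda>x::real. (v 0 \<bullet> v 0 + ln (u 0 \<bullet> u 0)) + - ln x) at_top (at_right 0)"
    by (rule filterlim_tendsto_add_at_top[OF tendsto_const])
      (use ln_at_0 in \<open>simp add: filterlim_uminus_at_bot\<close>)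
  from filterlim_compose[OF this filterlim_uu]
  have "filterlim (\<lambda>t. (v 0 \<bullet> v 0 + ln (u 0 \<bullet> u 0)) + - ln (u t \<bullet> u t)) at_top (at_left T)" .
  moreover have ev: "\<forall>\<^sub>F t in at_left T. (v 0 \<bullet> v 0 + ln (u 0 \<bullet> u 0)) + - ln (u t \<bullet> u t) = v t \<bullet> v t"
    using near_T by eventually_elim (simp only: vv_eq diff_conv_add_uminus)
  ultimately show ?thesis using filterlim_cong[OF refl refl ev] by blast
qed

lemma tendsto_uu_vv: "((\<lambda>t. (u t \<bullet> u t) * (v t \<bullet> v t)) \<longlongrightarrow> 0) (at_left T)"
proof (rule Lim_transform_eventually)
  show "((\<lambda>t. (u t \<bullet> u t) * ((v 0 \<bullet> v 0 + ln (u 0 \<bullet> u 0)) - ln (u t \<bullet> u t))) \<longlongrightarrow> 0) (at_left T)"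
    by (rule filterlim_compose[OF tendsto_mult_ln_at_right_0 filterlim_uu])
  show "\<forall>\<^sub>F t in at_left T. (u t \<bullet> u t) * ((v 0 \<bullet> v 0 + ln (u 0 \<bullet> u 0)) - ln (u t \<bullet> u t)) = (u t \<bullet> u t) * (v t \<bullet> v t)"
    using near_T by eventually_elim (simp only: vv_eq)
qed

lemma tendsto_uv_squared: "((\<lambda>t. (u t \<bullet> v t)\<^sup>2) \<longlongrightarrow> 0) (at_left T)"
  by (rule tendsto_sandwich[OF _ _ tendsto_const tendsto_uu_vv])
    (auto intro!: always_eventually Cauchy_Schwarz_ineq)

lemma tendsto_uv: "((\<lambda>t. u t \<bullet> v t) \<longlongrightarrow> 0) (at_left T)"
  using tendsto_real_sqrt[OF tendsto_uv_squared] by (simp add: tendsto_rabs_zero_iff)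

lemma angular_momentum_0: "(u 0 \<bullet> u 0) * (v 0 \<bullet> v 0) = (u 0 \<bullet> v 0)\<^sup>2"
proof -
  have "((\<lambda>t. (u t \<bullet> u t) * (v t \<bullet> v t) - (u t \<bullet> v t)\<^sup>2) \<longlongrightarrow> 0 - 0) (at_left T)"
    by (intro tendsto_diff tendsto_uu_vv tendsto_uv_squared)
  moreover have "\<forall>\<^sub>F t in at_left T. (u t \<bullet> u t) * (v t \<bullet> v t) - (u t \<bullet> v t)\<^sup>2 = (u 0 \<bullet> u 0) * (v 0 \<bullet> v 0) - (u 0 \<bullet> v 0)\<^sup>2"
    using near_T by eventually_elim (rule log_orbit_angular_momentum[OF orb], use T in auto)
  ultimately have "((\<lambda>t. (u 0 \<bullet> u 0) * (v 0 \<bullet> v 0) - (u 0 \<bullet> v 0)\<^sup>2) \<longlongrightarrow> 0) (at_left T)"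
    by (simp add: tendsto_cong)
  then have "(u 0 \<bullet> u 0) * (v 0 \<bullet> v 0) - (u 0 \<bullet> v 0)\<^sup>2 = 0"
    by (simp only: tendsto_const_iff trivial_limit_at_left_real not_False_eq_True)
  then show ?thesis by linarith
qed

definition e :: 'a where "e = u 0 /\<^sub>R norm (u 0)"

lemma u0_nonzero: "u 0 \<noteq> 0"
  using log_orbitD(1)[OF orb, of 0] T by auto

lemma norm_e: "norm e = 1"
  using u0_nonzero by (simp add: e_def)

text \<open>Reflection in the line of \<open>e\<close> fixes the initial state, hence by uniqueness
  the whole orbit, and its fixed points are the multiples of \<open>e\<close>.\<close>

lemma collinear:
  assumes "t \<in> {0..<T}"
  shows "u t = (e \<bullet> u t) *\<^sub>R e" "v t = (e \<bullet> v t) *\<^sub>R e"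
proof -
  have ee: "e \<bullet> e = 1" using norm_e by (simp add: norm_eq_1)
  have u0: "u 0 = norm (u 0) *\<^sub>R e" using u0_nonzero by (simp add: e_def)
  \<comment> \<open>Up to the factor \<open>(norm (u 0))\<^sup>2\<close>, the squared transverse
    part of the initial velocity is the squared angular momentum.\<close>
  have "norm (v 0 - (e \<bullet> v 0) *\<^sub>R e) ^ 2 = 0"
  proof -
    have "norm (v 0 - (e \<bullet> v 0) *\<^sub>R e) ^ 2 = v 0 \<bullet> v 0 - (e \<bullet> v 0)\<^sup>2"
      unfolding power2_norm_eq_inner using ee by (simp add: inner_diff inner_commute power2_eq_square)
    moreover have "(norm (u 0))\<^sup>2 * (v 0 \<bullet> v 0) = (norm (u 0))\<^sup>2 * (e \<bullet> v 0)\<^sup>2"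
    proof -
      have "u 0 \<bullet> v 0 = norm (u 0) * (e \<bullet> v 0)" using u0_nonzero by (simp add: e_def)
      then show ?thesis using angular_momentum_0 by (simp only: power2_norm_eq_inner power_mult_distrib)
    qed
    ultimately show ?thesis using u0_nonzero by simp
  qed
  then have v0: "v 0 = (e \<bullet> v 0) *\<^sub>R e" by simp
  have o: "log_orbit 0 {0..t} u v" by (rule log_orbit_subset[OF orb]) (use assms in auto)
  have "e \<bullet> u 0 = norm (u 0)" using u0_nonzero by (simp add: e_def dot_square_norm power2_eq_square)
  then have "axis_reflection e (u 0) = u 0" "axis_reflection e (v 0) = v 0"
    using u0 v0 by (simp_all only: axis_reflection_eq_self_iff)
  then have "axis_reflection e (u t) = u t \<and> axis_reflection e (v t) = v t"
    using assms
    by (intro log_orbit_unique[OF o log_orbit_isometry[OF o bounded_linear_axis_reflection axis_reflection_isometry[OF norm_e]]]) auto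
  then show "u t = (e \<bullet> u t) *\<^sub>R e" "v t = (e \<bullet> v t) *\<^sub>R e"
    by (simp_all only: axis_reflection_eq_self_iff)
qed

text \<open>Close to \<open>T\<close> the function \<open>u \<bullet> v\<close> grows at least at
  unit rate, and it tends to 0. Unlike mere negativity, the explicit gap survives perturbation: an
  error of at most \<open>T - s\<close> leaves a nearby orbit inward up to time
  \<open>s\<close>.\<close>

lemma eventually_uv_le: "\<forall>\<^sub>F t in at_left T. u t \<bullet> v t \<le> t - T"
proof -
  have "\<forall>\<^sub>F t in at_left T. 2 \<le> v t \<bullet> v t"
    using filterlim_vv by (simp add: filterlim_at_top)
  with near_T have "\<forall>\<^sub>F t in at_left T. t \<in> {0..<T} \<and> 2 \<le> v t \<bullet> v t" by eventually_elim simp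
  then obtain b where b: "b < T" "\<And>t. b < t \<Longrightarrow> t < T \<Longrightarrow> t \<in> {0..<T} \<and> 2 \<le> v t \<bullet> v t"
    by (auto simp: eventually_at_left_field)
  have "u t \<bullet> v t \<le> t - T" if t: "t \<in> {b<..<T}" for t
  proof -
    have "u t \<bullet> v t - t \<le> u s \<bullet> v s - s" if s: "s \<in> {t<..<T}" for s
    proof (rule has_real_derivative_nonneg_imp_le[where f = "\<lambda>t. u t \<bullet> v t - t"])
      fix r assume r: "r \<in> {t..s}"
      have o: "log_orbit 0 {t..s} u v" by (rule log_orbit_subset[OF orb]) (use b(2)[of t] t s in auto)
      show "((\<lambda>t. u t \<bullet> v t - t) has_real_derivative v r \<bullet> v r - (u r \<bullet> u r) / (u r \<bullet> u r + 0\<^sup>2) - 1) (at r within {t..s})"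
        by (intro DERIV_diff log_orbit_derivatives[OF o r] DERIV_ident)
      show "0 \<le> v r \<bullet> v r - (u r \<bullet> u r) / (u r \<bullet> u r + 0\<^sup>2) - 1"
        using b(2)[of r] r t s log_orbitD(1)[OF o r] by simp
    qed (use s in auto)
    then have "\<forall>\<^sub>F s in at_left T. u t \<bullet> v t - t \<le> u s \<bullet> v s - s"
      using t by (intro eventually_at_leftI[of t]) auto
    moreover have "((\<lambda>s. u s \<bullet> v s - s) \<longlongrightarrow> 0 - T) (at_left T)"
      by (intro tendsto_diff tendsto_uv tendsto_ident_at)
    ultimately have "u t \<bullet> v t - t \<le> 0 - T"
      by (intro tendsto_lowerbound[of "\<lambda>s. u s \<bullet> v s - s" _ "at_left T"]) (auto simp: trivial_limit_at_left_real)
    then show ?thesis by simp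
  qed
  then show ?thesis using b(1) by (intro eventually_at_leftI[of b]) auto
qed

end

section \<open>Passage of smoothed orbits near the collision\<close>

text \<open>This plays the role of an eventuality for small \<epsilon> and nearby data, but it
  ranges over orbits instead of values of the flow, so that velocities are available and an orbit
  can be restarted at a later time.\<close>

definition eventually_smoothed ::
    "real set \<Rightarrow> 'a::real_inner \<Rightarrow> 'a \<Rightarrow> ((real \<Rightarrow> 'a) \<Rightarrow> (real \<Rightarrow> 'a) \<Rightarrow> bool) \<Rightarrow> bool" where
  "eventually_smoothed J x y P \<longleftrightarrow> (\<exists>d>0. \<forall>\<epsilon> U W.
     \<bar>\<epsilon>\<bar> < d \<longrightarrow> log_orbit \<epsilon> J U W \<longrightarrow> dist (U 0) x < d \<longrightarrow> dist (W 0) y < d \<longrightarrow> P U W)"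

lemma eventually_smoothedI:
  assumes "0 < d" "\<And>\<epsilon> U W. \<bar>\<epsilon>\<bar> < d \<Longrightarrow> log_orbit \<epsilon> J U W \<Longrightarrow> dist (U 0) x < d \<Longrightarrow> dist (W 0) y < d \<Longrightarrow> P U W"
  shows "eventually_smoothed J x y P"
  unfolding eventually_smoothed_def
  using assms by (intro exI[of _ d]) simp

lemma eventually_smoothed_mono:
  assumes "eventually_smoothed I x y P" "I \<subseteq> J"
    and imp: "\<And>\<epsilon> U W. log_orbit \<epsilon> J U W \<Longrightarrow> P U W \<Longrightarrow> Q U W"
  shows "eventually_smoothed J x y Q"
proof -
  from assms(1) obtain d where d: "0 < d" "\<forall>\<epsilon> U W. \<bar>\<epsilon>\<bar> < d \<longrightarrow> log_orbit \<epsilon> I U W \<longrightarrow> dist (U 0) x < d \<longrightarrow> dist (W 0) y < d \<longrightarrow> P U W"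
    unfolding eventually_smoothed_def by (elim exE conjE)
  show ?thesis
  proof (rule eventually_smoothedI[OF d(1)])
    fix \<epsilon> U W
    assume *: "\<bar>\<epsilon>\<bar> < d" "log_orbit \<epsilon> J U W" "dist (U 0) x < d" "dist (W 0) y < d"
    show "Q U W"
      by (rule imp[OF *(2) d(2)[rule_format, OF *(1) log_orbit_subset[OF *(2) assms(2)] *(3,4)]])
  qed
qed

lemma eventually_smoothed_conj:
  assumes "eventually_smoothed J x y P" "eventually_smoothed J x y Q"
  shows "eventually_smoothed J x y (\<lambda>U W. P U W \<and> Q U W)"
proof -
  from assms(1) obtain d where d: "0 < d" "\<forall>\<epsilon> U W. \<bar>\<epsilon>\<bar> < d \<longrightarrow> log_orbit \<epsilon> J U W \<longrightarrow> dist (U 0) x < d \<longrightarrow> dist (W 0) y < d \<longrightarrow> P U W"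
    unfolding eventually_smoothed_def by (elim exE conjE)
  from assms(2) obtain d' where d': "0 < d'" "\<forall>\<epsilon> U W. \<bar>\<epsilon>\<bar> < d' \<longrightarrow> log_orbit \<epsilon> J U W \<longrightarrow> dist (U 0) x < d' \<longrightarrow> dist (W 0) y < d' \<longrightarrow> Q U W"
    unfolding eventually_smoothed_def by (elim exE conjE)
  show ?thesis
  proof (rule eventually_smoothedI[of "min d d'"])
    fix \<epsilon> U W
    assume *: "\<bar>\<epsilon>\<bar> < min d d'" "log_orbit \<epsilon> J U W" "dist (U 0) x < min d d'" "dist (W 0) y < min d d'"
    show "P U W \<and> Q U W"
      by (intro conjI d(2)[rule_format, OF _ *(2)] d'(2)[rule_format, OF _ *(2)]) (use * in simp_all)
  qed (use d(1) d'(1) in simp)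
qed

lemma log_orbit_eventually_close:
  assumes "log_orbit 0 {0..T} u v" "0 \<le> T" "0 < \<eta>"
  shows "eventually_smoothed {0..T} (u 0) (v 0) (\<lambda>U W. \<forall>t\<in>{0..T}. dist (U t) (u t) < \<eta> \<and> dist (W t) (v t) < \<eta>)"
  using log_orbit_uniform_stability[OF assms] unfolding eventually_smoothed_def .

text \<open>If \<open>a\<close> is almost orthogonal to \<open>e\<close>, the reflection is almost
  minus the identity on the line of \<open>e\<close>. The error \<open>\<delta>'\<close> counts
  twice through \<open>a \<bullet> x\<close> and once directly.\<close>

lemma axis_reflection_close:
  fixes x y a e :: "'a::real_inner"
  assumes "norm a = 1" "norm e = 1" "y = (e \<bullet> y) *\<^sub>R e" "\<bar>a \<bullet> e\<bar> \<le> \<delta>" "norm (x - y) \<le> \<delta>'"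
  shows "norm (axis_reflection a x + y) \<le> 2 * \<delta> * norm y + 3 * \<delta>'"
proof -
  have "a \<bullet> y = (e \<bullet> y) * (a \<bullet> e)" by (subst assms(3)) simp
  then have "\<bar>a \<bullet> y\<bar> = \<bar>e \<bullet> y\<bar> * \<bar>a \<bullet> e\<bar>" by (simp add: abs_mult)
  also have "\<dots> \<le> norm y * \<delta>"
    using Cauchy_Schwarz_ineq2[of e y] assms(2,4) by (intro mult_mono) auto
  finally have 1: "\<bar>a \<bullet> y\<bar> \<le> norm y * \<delta>" .
  have "\<bar>a \<bullet> (x - y)\<bar> \<le> \<delta>'"
    using Cauchy_Schwarz_ineq2[of a "x - y"] assms(1,5) by simp
  then have ax: "\<bar>a \<bullet> x\<bar> \<le> norm y * \<delta> + \<delta>'" using 1 by (simp add: inner_diff_right)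
  have eq: "axis_reflection a x + y = (2 * (a \<bullet> x)) *\<^sub>R a - (x - y)"
    by (simp add: axis_reflection_def)
  have "norm ((2 * (a \<bullet> x)) *\<^sub>R a) = 2 * \<bar>a \<bullet> x\<bar>" using assms(1) by (simp add: abs_mult)
  then have "norm (axis_reflection a x + y) \<le> 2 * \<bar>a \<bullet> x\<bar> + norm (x - y)"
    unfolding eq by (metis norm_triangle_ineq4)
  moreover have "2 * \<bar>a \<bullet> x\<bar> + norm (x - y) \<le> 2 * (norm y * \<delta> + \<delta>') + \<delta>'"
    using ax assms(5) by (intro add_mono mult_left_mono) auto
  ultimately have "norm (axis_reflection a x + y) \<le> 2 * (norm y * \<delta> + \<delta>') + \<delta>'" by (rule order_trans)
  then show ?thesis by (simp add: algebra_simps)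
qed

context log_collision
begin

text \<open>The pericentre time and axis are what the reflection argument needs afterwards; the
  bound on \<open>U T\<close> is the limit at the collision time itself.\<close>

lemma passage:
  assumes perp: "\<And>w::'a. \<exists>a. norm a = 1 \<and> a \<bullet> w = 0" and "0 < \<eta>"
  shows "eventually_smoothed {0..} (u 0) (v 0) (\<lambda>U W. norm (U T) < \<eta> \<and> (\<exists>\<tau> a. 0 < \<tau> \<and> \<bar>\<tau> - T\<bar> < \<eta> \<and> norm a = 1 \<and> \<bar>a \<bullet> e\<bar> < \<eta> \<and>
      U \<tau> = (a \<bullet> U \<tau>) *\<^sub>R a \<and> a \<bullet> W \<tau> = 0))"
proof -
  have "\<forall>\<^sub>F t in at_left T. t \<in> {0..<T} \<and> u t \<bullet> v t \<le> t - T \<and> T - \<eta> / 2 < t \<and> norm (u t) < \<eta> / 2"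
  proof (intro eventually_conj near_T eventually_uv_le)
    show "\<forall>\<^sub>F t in at_left T. T - \<eta> / 2 < t"
      using \<open>0 < \<eta>\<close> by (intro eventually_at_leftI[of "T - \<eta> / 2"]) auto
    show "\<forall>\<^sub>F t in at_left T. norm (u t) < \<eta> / 2"
      using tendstoD[OF lim, of "\<eta> / 2"] \<open>0 < \<eta>\<close> by simp
  qed
  then obtain b where b: "b < T" "\<And>t. b < t \<Longrightarrow> t < T \<Longrightarrow>
      t \<in> {0..<T} \<and> u t \<bullet> v t \<le> t - T \<and> T - \<eta> / 2 < t \<and> norm (u t) < \<eta> / 2"
    by (auto simp: eventually_at_left_field)
  define t0 where "t0 = (b + T) / 2"
  have t0: "b < t0" "t0 < T" using b(1) by (auto simp: t0_def)
  \<comment> \<open>The value 3 leaves the perturbed speed at least 2, enough for the pericentre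
    lemma; \<open>4 / \<eta>\<close> turns \<open>C * \<bar>a \<bullet> e\<bar> \<le> 2\<close> into
    \<open>\<bar>a \<bullet> e\<bar> \<le> \<eta> / 2\<close>.\<close>
  define C where "C = max 3 (4 / \<eta>)"
  \<comment> \<open>Past the midpoint of \<open>t0\<close> and \<open>T\<close>, every
    \<open>\<tau> \<ge> s\<close> satisfies \<open>2 * \<tau> - T > t0\<close>: the mirror image of
    the time \<open>T\<close> stays in the inward stretch.\<close>
  have "\<forall>\<^sub>F t in at_left T. (T + t0) / 2 < t \<and> t < T \<and> C\<^sup>2 < v t \<bullet> v t \<and> - (u t \<bullet> v t) < \<eta> / 4"
  proof (intro eventually_conj)
    show "\<forall>\<^sub>F t in at_left T. (T + t0) / 2 < t" "\<forall>\<^sub>F t in at_left T. t < T"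
      using t0 by (auto intro!: eventually_at_leftI[of "(T + t0) / 2"])
    show "\<forall>\<^sub>F t in at_left T. C\<^sup>2 < v t \<bullet> v t"
      using filterlim_vv by (simp add: filterlim_at_top_dense)
    have "((\<lambda>t. - (u t \<bullet> v t)) \<longlongrightarrow> - 0) (at_left T)" by (intro tendsto_minus tendsto_uv)
    then show "\<forall>\<^sub>F t in at_left T. - (u t \<bullet> v t) < \<eta> / 4"
      using \<open>0 < \<eta>\<close> by (intro order_tendstoD) auto
  qed
  then obtain s where s: "(T + t0) / 2 < s" "s < T" "C\<^sup>2 < v s \<bullet> v s" "- (u s \<bullet> v s) < \<eta> / 4"
    using eventually_happens'[OF trivial_limit_at_left_real] by blast
  have order: "b < t0" "t0 < s" "0 \<le> t0" "T - \<eta> / 2 < t0" using t0 s b(2)[OF t0] by auto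
  have o_s: "log_orbit 0 {0..s} u v" by (rule log_orbit_subset[OF orb]) (use s in auto)
  have "compact ((\<lambda>t. norm (u t) + norm (v t)) ` {0..s})"
    by (intro compact_continuous_image continuous_intros log_orbit_continuous[OF o_s]) simp
  from compact_imp_bounded[OF this] obtain M where
    M: "0 < M" "\<forall>x\<in>(\<lambda>t. norm (u t) + norm (v t)) ` {0..s}. norm x \<le> M"
    unfolding bounded_pos by blast
  have Muv: "norm (u t) \<le> M" "norm (v t) \<le> M" if "t \<in> {0..s}" for t
    using M(2)[rule_format, OF imageI[OF that]] norm_ge_zero[of "u t"] norm_ge_zero[of "v t"]
    unfolding real_norm_def by linarith+
  \<comment> \<open>The entry \<open>T - s\<close> keeps the perturbed orbit inward on
    \<open>{t0..s}\<close>, the entry \<open>\<eta> / 4\<close> puts the pericentre within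
    \<open>\<eta> / 2\<close> after \<open>s\<close>, and \<open>2 * M + 1\<close> is the loss in
    \<open>inner_close\<close>.\<close>
  define \<theta> where "\<theta> = min (min 1 (\<eta> / 2)) (min (T - s) (\<eta> / 4) / (2 * M + 1))"
  have \<theta>: "0 < \<theta>" "\<theta> \<le> 1" "\<theta> \<le> \<eta> / 2" "\<theta> * (2 * M + 1) \<le> min (T - s) (\<eta> / 4)"
  proof -
    have M': "0 < 2 * M + 1" and "0 < min (T - s) (\<eta> / 4)" using M(1) s(2) \<open>0 < \<eta>\<close> by simp_all
    then show "0 < \<theta>" unfolding \<theta>_def min_less_iff_conj using \<open>0 < \<eta>\<close> by (intro conjI divide_pos_pos) simp_all
    show "\<theta> \<le> 1" "\<theta> \<le> \<eta> / 2" unfolding \<theta>_def by (simp_all only: min_le_iff_disj order_refl simp_thms)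
    have "\<theta> \<le> min (T - s) (\<eta> / 4) / (2 * M + 1)" unfolding \<theta>_def by (rule min.cobounded2)
    then show "\<theta> * (2 * M + 1) \<le> min (T - s) (\<eta> / 4)" by (simp only: pos_le_divide_eq[OF M'])
  qed
  have "0 \<le> s" using order by simp
  from log_orbit_eventually_close[OF o_s this \<theta>(1)] show ?thesis
  proof (rule eventually_smoothed_mono)
    show "{0..s} \<subseteq> {0..}" by auto
    fix \<epsilon> U W
    assume O: "log_orbit \<epsilon> {0..} U W" and cl: "\<forall>t\<in>{0..s}. dist (U t) (u t) < \<theta> \<and> dist (W t) (v t) < \<theta>"
    have sub: "log_orbit \<epsilon> {a..b} U W" if "0 \<le> a" for a b
      by (rule log_orbit_subset[OF O]) (use that in auto)
    have close: "norm (U t - u t) \<le> \<theta>" "norm (W t - v t) \<le> \<theta>" if "t \<in> {0..s}" for t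
      using cl that by (auto simp: dist_norm intro: less_imp_le)
    have UW: "\<bar>U t \<bullet> W t - u t \<bullet> v t\<bar> \<le> min (T - s) (\<eta> / 4)" if "t \<in> {0..s}" for t
      using inner_close[OF close[OF that] Muv[OF that] \<theta>(2)] \<theta>(4) by linarith
    have in1: "U t \<bullet> W t \<le> 0" if "t \<in> {t0..s}" for t
      using UW[of t] b(2)[of t] that order s(2) by (auto simp: abs_le_iff)
    have sin: "s \<in> {0..s}" using order by simp
    have C: "3 \<le> C" "4 / \<eta> \<le> C" by (auto simp: C_def)
    have vs: "C < norm (v s)"
      using s(3) C(1) by (auto simp: norm_eq_sqrt_inner intro: real_less_rsqrt)
    have "2 \<le> norm (W s)"
      using norm_triangle_ineq3[of "W s" "v s"] close(2)[OF sin] \<theta>(2) vs C(1) by linarith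
    then have "2\<^sup>2 \<le> (norm (W s))\<^sup>2" by (intro power_mono) auto
    then have fast: "2 \<le> W s \<bullet> W s" by (simp add: power2_norm_eq_inner)
    \<comment> \<open>The pericentre lemma wants a strict sign; in the borderline case
      \<open>s\<close> itself is the pericentre.\<close>
    have "U s \<bullet> W s < 0 \<or> U s \<bullet> W s = 0" using in1[of s] order by auto
    then obtain \<tau> where \<tau>: "\<tau> \<in> {s..s + \<eta> / 2}" "U \<tau> \<bullet> W \<tau> = 0" "\<And>t. t \<in> {s..\<tau>} \<Longrightarrow> U t \<bullet> W t \<le> 0"
    proof
      assume neg: "U s \<bullet> W s < 0"
      have "\<bar>U s \<bullet> W s - u s \<bullet> v s\<bar> \<le> \<eta> / 4" using UW[OF sin] by simp
      then have le: "- (U s \<bullet> W s) \<le> \<eta> / 2" using s(4) by linarith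
      have "0 \<le> \<eta> / 2" using \<open>0 < \<eta>\<close> by simp
      then show thesis using log_orbit_pericentre[OF sub _ neg le fast] order that by auto
    next
      assume "U s \<bullet> W s = 0"
      then show thesis using \<open>0 < \<eta>\<close> by (intro that[of s]) auto
    qed
    have \<tau>T: "0 < \<tau>" "\<bar>\<tau> - T\<bar> < \<eta>" using \<tau>(1) order s t0 by auto
    obtain a where a: "norm a = 1" "U \<tau> = (a \<bullet> U \<tau>) *\<^sub>R a" "a \<bullet> W \<tau> = 0"
    \<comment> \<open>If the orbit runs exactly through the origin, its position determines no axis;
      any unit vector orthogonal to the velocity then serves, which is why \<open>perp\<close> is
      assumed.\<close>
    proof (cases "U \<tau> = 0")
      case True
      obtain a where "norm a = 1" "a \<bullet> W \<tau> = 0" using perp by blast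
      then show thesis using True by (intro that) auto
    next
      case False
      have "(U \<tau> /\<^sub>R norm (U \<tau>)) \<bullet> U \<tau> = norm (U \<tau>)"
        using False by (simp add: dot_square_norm power2_eq_square)
      then show thesis using False \<tau>(2) by (intro that[of "U \<tau> /\<^sub>R norm (U \<tau>)"]) simp_all
    qed
    have "\<bar>a \<bullet> W s\<bar> \<le> 1"
      using \<tau>(1) order by (intro log_orbit_transverse_velocity[OF sub _ a(1,3) \<tau>(3)]) auto
    moreover have "\<bar>a \<bullet> (W s - v s)\<bar> \<le> 1"
      using Cauchy_Schwarz_ineq2[of a "W s - v s"] a(1) close(2)[OF sin] \<theta>(2) by simp
    ultimately have av: "\<bar>a \<bullet> v s\<bar> \<le> 2" by (simp add: inner_diff_right)
    have cv: "v s = (e \<bullet> v s) *\<^sub>R e" by (rule collinear) (use order s in auto)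
    have nv: "norm (v s) = \<bar>e \<bullet> v s\<bar>" by (subst cv) (simp add: norm_e)
    have "a \<bullet> v s = (e \<bullet> v s) * (a \<bullet> e)" by (subst cv) simp
    then have "norm (v s) * \<bar>a \<bullet> e\<bar> \<le> 2" using av nv by (simp add: abs_mult)
    then have "C * \<bar>a \<bullet> e\<bar> \<le> 2" using mult_right_mono[of C "norm (v s)" "\<bar>a \<bullet> e\<bar>"] vs by linarith
    then have "4 / \<eta> * \<bar>a \<bullet> e\<bar> \<le> 2" using mult_right_mono[OF C(2), of "\<bar>a \<bullet> e\<bar>"] by linarith
    then have ae: "\<bar>a \<bullet> e\<bar> < \<eta>" using \<open>0 < \<eta>\<close> by (simp add: field_simps)
    have in2: "U t \<bullet> W t \<le> 0" if "t \<in> {t0..\<tau>}" for t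
      using in1[of t] \<tau>(3)[of t] that by (cases "t \<le> s") auto
    have dec: "norm (U t) \<le> norm (U t0)" if t: "t \<in> {t0..\<tau>}" for t
      by (rule log_orbit_inward_norm_le[OF sub]) (use order t in2 in auto)
    \<comment> \<open>Up to the pericentre the distance does not increase; after it,
      \<open>U T\<close> is the mirror image of a position on the inward arc.\<close>
    have "norm (U T) \<le> norm (U t0)"
    proof (cases "T \<le> \<tau>")
      case True
      then show ?thesis using dec t0 by auto
    next
      case False
      define r where "r = T - \<tau>"
      have r: "r \<in> {0..\<tau>}" "\<tau> - r \<in> {t0..\<tau>}"
        using False \<tau>(1) s(1) order by (auto simp: r_def)
      have "U (\<tau> + r) = axis_reflection a (U (\<tau> - r))"
        using log_orbit_axis_symmetry(1)[OF sub[OF order_refl] a r(1)] .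
      then have "U T \<bullet> U T = U (\<tau> - r) \<bullet> U (\<tau> - r)"
        by (simp add: axis_reflection_isometry[OF a(1)] r_def)
      then have "norm (U T) = norm (U (\<tau> - r))" by (simp add: norm_eq_sqrt_inner)
      then show ?thesis using dec[OF r(2)] by simp
    qed
    also have "\<dots> \<le> norm (u t0) + \<theta>"
      using norm_triangle_sub[of "U t0" "u t0"] close(1)[of t0] order by auto
    also have "\<dots> < \<eta>" using b(2)[OF t0] \<theta>(3) by auto
    finally show "norm (U T) < \<eta> \<and> (\<exists>\<tau> a. 0 < \<tau> \<and> \<bar>\<tau> - T\<bar> < \<eta> \<and> norm a = 1 \<and> \<bar>a \<bullet> e\<bar> < \<eta> \<and>
      U \<tau> = (a \<bullet> U \<tau>) *\<^sub>R a \<and> a \<bullet> W \<tau> = 0)" using \<tau>T a ae by blast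
  qed
qed

text \<open>The bound \<open>t < 2 * T\<close> is strict because reflection reaches only
  \<open>2 * \<tau>\<close> and \<tau> is merely close to \<open>T\<close>. The velocity is included
  so that the state at \<open>t\<close> can serve as new initial data.\<close>

lemma after_passage:
  assumes perp: "\<And>w::'a. \<exists>a. norm a = 1 \<and> a \<bullet> w = 0" and "0 < \<eta>" and t: "T < t" "t < 2 * T"
  shows "eventually_smoothed {0..} (u 0) (v 0) (\<lambda>U W. dist (U t) (- u (2 * T - t)) < \<eta> \<and> dist (W t) (v (2 * T - t)) < \<eta>)"
proof -
  define s where "s = 2 * T - t"
  have s: "0 < s" "s < T" using t by (auto simp: s_def)
  \<comment> \<open>The mirror time \<open>2 * \<tau> - t\<close> varies around \<open>s\<close>, so
    closeness is needed slightly beyond \<open>s\<close>, yet on an interval ending before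
    \<open>T\<close>.\<close>
  define S where "S = (s + T) / 2"
  have S: "s < S" "S < T" using s by (auto simp: S_def)
  have o: "log_orbit 0 {0..S} u v" by (rule log_orbit_subset[OF orb]) (use S in auto)
  define M where "M = norm (u s) + norm (v s) + 1"
  have M: "0 < M" "norm (u s) \<le> M" "norm (v s) \<le> M" by (auto simp: M_def add_nonneg_pos)
  \<comment> \<open>Replacing the mirror time by \<open>s\<close> costs a second \<kappa>, and the
    reflection triples the error: \<open>3 * (2 * \<kappa>) = \<eta> / 2\<close>.\<close>
  define \<kappa> where "\<kappa> = \<eta> / 12"
  have \<kappa>: "0 < \<kappa>" using \<open>0 < \<eta>\<close> by (simp add: \<kappa>_def)
  obtain \<sigma> where \<sigma>: "0 < \<sigma>" "\<And>r. r \<in> {0..S} \<Longrightarrow> dist r s < \<sigma> \<Longrightarrow> dist (u r) (u s) < \<kappa> \<and> dist (v r) (v s) < \<kappa>"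
  proof -
    have "s \<in> {0..S}" using s S by auto
    from continuous_on_iff[THEN iffD1, OF log_orbit_continuous(1)[OF o], rule_format, OF this \<kappa>]
      continuous_on_iff[THEN iffD1, OF log_orbit_continuous(2)[OF o], rule_format, OF this \<kappa>]
    obtain \<sigma>1 \<sigma>2 where "0 < \<sigma>1" "0 < \<sigma>2" "\<And>r. r \<in> {0..S} \<Longrightarrow> dist r s < \<sigma>1 \<Longrightarrow> dist (u r) (u s) < \<kappa>"
      "\<And>r. r \<in> {0..S} \<Longrightarrow> dist r s < \<sigma>2 \<Longrightarrow> dist (v r) (v s) < \<kappa>" by metis
    then show thesis by (intro that[of "min \<sigma>1 \<sigma>2"]) auto
  qed
  \<comment> \<open>In order, the entries secure continuity at \<open>s\<close>,
    \<open>t \<le> 2 * \<tau>\<close>, \<open>2 * \<tau> - t \<le> S\<close>,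
    \<open>\<tau> \<le> t\<close>, and a contribution of at most \<open>\<eta> / 4\<close> from the
    tilt of the axis.\<close>
  define \<mu> where "\<mu> = min (min (\<sigma> / 2) (s / 2)) (min (min ((S - s) / 2) (t - T)) (\<eta> / (8 * M)))"
  have \<mu>: "0 < \<mu>" "2 * \<mu> \<le> \<sigma>" "2 * \<mu> \<le> s" "2 * \<mu> \<le> S - s" "\<mu> \<le> t - T" "\<mu> \<le> \<eta> / (8 * M)"
    using \<sigma>(1) s S t M(1) \<open>0 < \<eta>\<close> by (auto simp: \<mu>_def min_def)
  have \<mu>M: "2 * \<mu> * M \<le> \<eta> / 4" using \<mu>(6) M(1) by (simp add: field_simps)
  have "0 \<le> S" using s S by simp
  have "{0..S} \<subseteq> {0..}" by auto
  from eventually_smoothed_conj[OF passage[OF perp \<mu>(1)]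
      eventually_smoothed_mono[OF log_orbit_eventually_close[OF o \<open>0 \<le> S\<close> \<kappa>] this]]
  have "eventually_smoothed {0..} (u 0) (v 0) (\<lambda>U W.
      (norm (U T) < \<mu> \<and> (\<exists>\<tau> a. 0 < \<tau> \<and> \<bar>\<tau> - T\<bar> < \<mu> \<and> norm a = 1 \<and> \<bar>a \<bullet> e\<bar> < \<mu> \<and>
        U \<tau> = (a \<bullet> U \<tau>) *\<^sub>R a \<and> a \<bullet> W \<tau> = 0)) \<and>
      (\<forall>t\<in>{0..S}. dist (U t) (u t) < \<kappa> \<and> dist (W t) (v t) < \<kappa>))" .
  then show ?thesis
  proof (rule eventually_smoothed_mono[OF _ order_refl], elim conjE exE)
    fix \<epsilon> U W \<tau> a
    assume O: "log_orbit \<epsilon> {0..} U W" and cl: "\<forall>t\<in>{0..S}. dist (U t) (u t) < \<kappa> \<and> dist (W t) (v t) < \<kappa>"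
      and \<tau>: "0 < \<tau>" "\<bar>\<tau> - T\<bar> < \<mu>" and a: "norm a = 1" "\<bar>a \<bullet> e\<bar> < \<mu>" "U \<tau> = (a \<bullet> U \<tau>) *\<^sub>R a" "a \<bullet> W \<tau> = 0"
    define r where "r = t - \<tau>"
    have r: "r \<in> {0..\<tau>}" "\<tau> + r = t" using \<tau> \<mu> s by (auto simp: r_def s_def)
    have q: "\<tau> - r \<in> {0..S}" "dist (\<tau> - r) s < \<sigma>"
      using \<tau> \<mu> s by (auto simp: r_def s_def dist_real_def)
    have sub: "log_orbit \<epsilon> {0..b} U W" for b by (rule log_orbit_subset[OF O]) auto
    have "dist (U (\<tau> - r)) (u (\<tau> - r)) < \<kappa>" "dist (W (\<tau> - r)) (v (\<tau> - r)) < \<kappa>"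
      using cl q(1) by blast+
    then have "dist (U (\<tau> - r)) (u s) \<le> 2 * \<kappa>" "dist (W (\<tau> - r)) (v s) \<le> 2 * \<kappa>"
      using \<sigma>(2)[OF q] dist_triangle[of "U (\<tau> - r)" "u s" "u (\<tau> - r)"]
        dist_triangle[of "W (\<tau> - r)" "v s" "v (\<tau> - r)"] by linarith+
    then have cl: "norm (U (\<tau> - r) - u s) \<le> 2 * \<kappa>" "norm (W (\<tau> - r) - v s) \<le> 2 * \<kappa>"
      by (simp_all add: dist_norm)
    have "s \<in> {0..<T}" using s by simp
    note col = collinear[OF this]
    have bound: "2 * \<mu> * norm y + 3 * (2 * \<kappa>) < \<eta>" if "norm y \<le> M" for y :: 'a
    proof -
      have "2 * \<mu> * norm y \<le> 2 * \<mu> * M" using that \<mu>(1) by (intro mult_left_mono) auto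
      then show ?thesis using \<mu>M \<open>0 < \<eta>\<close> by (simp add: \<kappa>_def)
    qed
    have eq: "U t = axis_reflection a (U (\<tau> - r))" "W t = - axis_reflection a (W (\<tau> - r))"
      using log_orbit_axis_symmetry[OF sub a(1,3,4) r(1)] r(2) by simp_all
    have "norm (U t + u s) \<le> 2 * \<mu> * norm (u s) + 3 * (2 * \<kappa>)"
      unfolding eq by (rule axis_reflection_close[OF a(1) norm_e col(1) less_imp_le[OF a(2)] cl(1)])
    moreover have "norm (- W t + v s) \<le> 2 * \<mu> * norm (v s) + 3 * (2 * \<kappa>)"
      unfolding eq minus_minus by (rule axis_reflection_close[OF a(1) norm_e col(2) less_imp_le[OF a(2)] cl(2)])
    then have "norm (W t - v s) \<le> 2 * \<mu> * norm (v s) + 3 * (2 * \<kappa>)"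
      using norm_minus_commute[of "v s" "W t"] by simp
    ultimately show "dist (U t) (- u (2 * T - t)) < \<eta> \<and> dist (W t) (v (2 * T - t)) < \<eta>"
      using bound[OF M(2)] bound[OF M(3)] by (simp add: dist_norm s_def)
  qed
qed

lemma smoothing_limit:
  assumes perp: "\<And>w::'a. \<exists>a. norm a = 1 \<and> a \<bullet> w = 0" and t: "t \<in> {0..2 * T}"
  shows "\<exists>x. \<forall>\<eta>>0. eventually_smoothed {0..} (u 0) (v 0) (\<lambda>U W. dist (U t) x < \<eta>)"
proof -
  consider "t < T" | "t = T" | "T < t" by linarith
  then show ?thesis
  proof cases
    case 1
    have o: "log_orbit 0 {0..t} u v" by (rule log_orbit_subset[OF orb]) (use 1 in auto)
    have "0 \<le> t" "{0..t} \<subseteq> {0..}" using t by auto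
    then show ?thesis
      by (intro exI[of _ "u t"] allI impI eventually_smoothed_mono[OF log_orbit_eventually_close[OF o]]) auto
  next
    case 2
    show ?thesis unfolding 2
      by (intro exI[of _ 0] allI impI eventually_smoothed_mono[OF passage[OF perp] order_refl])
        (assumption | elim conjE | simp only: dist_norm diff_zero)+
  next
    case 3
    \<comment> \<open>Restart at \<open>p\<close>, which is below \<open>2 * T\<close> even for
      \<open>t = 2 * T\<close>. From there the reversed and negated collision orbit avoids the
      origin up to time \<open>t\<close>, so it is a legitimate comparison orbit.\<close>
    define p where "p = (T + t) / 2"
    have p: "T < p" "p < t" "p < 2 * T" using 3 t T by (auto simp: p_def)
    define c where "c = 2 * T - p"
    have "log_orbit 0 {0..t - p} (\<lambda>r. u (c - r)) (\<lambda>r. - v (c - r))"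
      by (rule log_orbit_reverse[OF orb]) (use t p in \<open>auto simp: c_def\<close>)
    from log_orbit_isometry[OF this, of uminus]
    have o: "log_orbit 0 {0..t - p} (\<lambda>r. - u (c - r)) (\<lambda>r. v (c - r))"
      by (simp add: bounded_linear_minus[OF bounded_linear_ident])
    show ?thesis
    proof (intro exI[of _ "- u (2 * T - t)"] allI impI)
      fix \<eta> :: real assume \<eta>: "0 < \<eta>"
      have "0 \<le> t - p" using p by simp
      from log_orbit_eventually_close[OF o this \<eta>]
      obtain d where d: "0 < d" "\<forall>\<epsilon> U W. \<bar>\<epsilon>\<bar> < d \<longrightarrow> log_orbit \<epsilon> {0..t - p} U W \<longrightarrow> dist (U 0) (- u (c - 0)) < d \<longrightarrow>
          dist (W 0) (v (c - 0)) < d \<longrightarrow> (\<forall>r\<in>{0..t - p}. dist (U r) (- u (c - r)) < \<eta> \<and> dist (W r) (v (c - r)) < \<eta>)"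
        unfolding eventually_smoothed_def by (elim exE conjE)
      from after_passage[OF perp d(1) p(1,3)]
      obtain d' where d': "0 < d'" "\<forall>\<epsilon> U W. \<bar>\<epsilon>\<bar> < d' \<longrightarrow> log_orbit \<epsilon> {0..} U W \<longrightarrow> dist (U 0) (u 0) < d' \<longrightarrow>
          dist (W 0) (v 0) < d' \<longrightarrow> dist (U p) (- u (2 * T - p)) < d \<and> dist (W p) (v (2 * T - p)) < d"
        unfolding eventually_smoothed_def by (elim exE conjE)
      show "eventually_smoothed {0..} (u 0) (v 0) (\<lambda>U W. dist (U t) (- u (2 * T - t)) < \<eta>)"
      proof (rule eventually_smoothedI[of "min d d'"])
        fix \<epsilon> U W
        assume *: "\<bar>\<epsilon>\<bar> < min d d'" "log_orbit \<epsilon> {0..} U W" "dist (U 0) (u 0) < min d d'" "dist (W 0) (v 0) < min d d'"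
        have "dist (U p) (- u (2 * T - p)) < d \<and> dist (W p) (v (2 * T - p)) < d"
          by (rule d'(2)[rule_format, OF _ *(2)]) (use * in simp_all)
        moreover have "log_orbit \<epsilon> {0..t - p} (\<lambda>r. U (p + r)) (\<lambda>r. W (p + r))"
          by (rule log_orbit_shift[OF *(2)]) (use p T in auto)
        ultimately have "\<forall>r\<in>{0..t - p}. dist (U (p + r)) (- u (c - r)) < \<eta> \<and> dist (W (p + r)) (v (c - r)) < \<eta>"
          using *(1) by (intro d(2)[THEN spec, THEN spec, THEN spec, THEN mp, THEN mp, THEN mp, THEN mp]) (simp_all add: c_def)
        from this[rule_format, of "t - p"] show "dist (U t) (- u (2 * T - t)) < \<eta>"
          using p by (simp add: c_def)
      qed (use d(1) d'(1) in simp)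
    qed
  qed
qed

end

section \<open>Joint limits of the smoothed flow\<close>

lemma GDERIV_unique:
  assumes "GDERIV F x :> g" "GDERIV F x :> h"
  shows "g = h"
proof -
  have "(\<lambda>y. y \<bullet> g) = (\<lambda>y. y \<bullet> h)"
    using assms unfolding gderiv_def by (rule has_derivative_unique)
  then have "\<forall>y. y \<bullet> g = y \<bullet> h" by (simp add: fun_eq_iff)
  then show ?thesis by (rule vector_eq_ldot[THEN iffD1])
qed

lemma GDERIV_log_potential:
  fixes x :: "'a::real_inner"
  assumes "0 < x \<bullet> x + \<epsilon>\<^sup>2"
  shows "GDERIV (\<lambda>x. - ln (sqrt ((norm x)\<^sup>2 + \<epsilon>\<^sup>2))) x :> log_force \<epsilon> x"
proof -
  have "((\<lambda>x. x \<bullet> x + \<epsilon>\<^sup>2) has_derivative (\<lambda>h. h \<bullet> (2 *\<^sub>R x))) (at x)"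
    by (auto intro!: derivative_eq_intros simp: inner_commute)
  then have "GDERIV (\<lambda>x. x \<bullet> x + \<epsilon>\<^sup>2) x :> 2 *\<^sub>R x" by (simp only: gderiv_def)
  moreover have "((\<lambda>N. - ln (sqrt N)) has_real_derivative - inverse (2 * (x \<bullet> x + \<epsilon>\<^sup>2))) (at (x \<bullet> x + \<epsilon>\<^sup>2))"
    using assms by (auto intro!: derivative_eq_intros simp: field_simps)
  ultimately have "GDERIV (\<lambda>x. - ln (sqrt (x \<bullet> x + \<epsilon>\<^sup>2))) x :> (- inverse (2 * (x \<bullet> x + \<epsilon>\<^sup>2))) *\<^sub>R (2 *\<^sub>R x)"
    by (rule GDERIV_DERIV_compose)
  moreover have "(- inverse (2 * N)) *\<^sub>R (2 *\<^sub>R x) = - (x /\<^sub>R N)" for N by simp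
  ultimately show ?thesis by (simp only: power2_norm_eq_inner log_force_def)
qed

text \<open>The gradient in \<open>solves\<close> is existentially quantified; its uniqueness
  identifies it with \<open>log_force\<close>. The condition on \<open>D\<close> fits both the
  punctured plane with \<open>\<epsilon> = 0\<close> and the whole plane with nonzero
  \<epsilon>.\<close>

lemma solves_log_iff:
  assumes D: "\<And>x. x \<in> D \<longleftrightarrow> 0 < x \<bullet> x + \<epsilon>\<^sup>2"
    and F: "F = (\<lambda>x. - ln (sqrt ((norm x)\<^sup>2 + \<epsilon>\<^sup>2)))"
  shows "solves D F \<nu> J u \<longleftrightarrow> (\<exists>v. u 0 = fst \<nu> \<and> v 0 = snd \<nu> \<and> log_orbit \<epsilon> J u v)"
proof -
  have G: "GDERIV F x :> log_force \<epsilon> x" if "x \<in> D" for x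
    unfolding F using that by (intro GDERIV_log_potential) (simp only: D)
  show ?thesis
  proof
    assume "solves D F \<nu> J u"
    then obtain v where v: "u 0 = fst \<nu>" "v 0 = snd \<nu>" "\<forall>t\<in>J. u t \<in> D"
      "\<forall>t\<in>J. (u has_vector_derivative v t) (at t within J) \<and>
        (\<exists>g. GDERIV F (u t) :> g \<and> (v has_vector_derivative g) (at t within J))"
      unfolding solves_def by (elim exE conjE)
    have "log_orbit \<epsilon> J u v"
      unfolding log_orbit_def
    proof
      fix t assume t: "t \<in> J"
      obtain g where "GDERIV F (u t) :> g" "(v has_vector_derivative g) (at t within J)"
        using v(4) t by blast
      moreover from this(1) have "g = log_force \<epsilon> (u t)"
        using G[of "u t"] v(3) t by (intro GDERIV_unique) simp_all
      ultimately show "0 < u t \<bullet> u t + \<epsilon>\<^sup>2 \<and> (u has_vector_derivative v t) (at t within J) \<and>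
          (v has_vector_derivative log_force \<epsilon> (u t)) (at t within J)"
        using v(3,4) t D[of "u t"] by simp
    qed
    with v(1,2) show "\<exists>v. u 0 = fst \<nu> \<and> v 0 = snd \<nu> \<and> log_orbit \<epsilon> J u v" by (intro exI conjI)
  next
    assume "\<exists>v. u 0 = fst \<nu> \<and> v 0 = snd \<nu> \<and> log_orbit \<epsilon> J u v"
    then obtain v where v: "u 0 = fst \<nu>" "v 0 = snd \<nu>" "log_orbit \<epsilon> J u v" by (elim exE conjE)
    have inD: "u t \<in> D" if "t \<in> J" for t using log_orbitD(1)[OF v(3) that] D by simp
    show "solves D F \<nu> J u"
      unfolding solves_def
    proof (intro conjI ballI exI[of _ v] v(1,2))
      fix t assume t: "t \<in> J"
      show "u t \<in> D" by (rule inD[OF t])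
      show "(u has_vector_derivative v t) (at t within J)" by (rule log_orbitD[OF v(3) t])
      show "\<exists>g. GDERIV F (u t) :> g \<and> (v has_vector_derivative g) (at t within J)"
        using G[OF inD[OF t]] log_orbitD(3)[OF v(3) t] by (intro exI conjI)
    qed
  qed
qed

lemma classical_solves_iff:
  "solves (- {0}) (radial (\<lambda>x. - ln x)) \<nu> J u \<longleftrightarrow> (\<exists>v. u 0 = fst \<nu> \<and> v 0 = snd \<nu> \<and> log_orbit 0 J u v)"
  by (rule solves_log_iff) auto

lemma smoothed_solves_iff:
  assumes "0 < \<epsilon>"
  shows "solves UNIV (radial (smoothed (\<lambda>x. - ln x) \<epsilon>)) \<nu> J u \<longleftrightarrow>
    (\<exists>v. u 0 = fst \<nu> \<and> v 0 = snd \<nu> \<and> log_orbit \<epsilon> J u v)"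
  by (rule solves_log_iff) (use assms in \<open>auto simp: smoothed_def add_nonneg_pos\<close>)

lemma flow_eqI:
  assumes "\<And>w. solves D F \<nu> {0..t} w \<longleftrightarrow> (\<exists>v. w 0 = fst \<nu> \<and> v 0 = snd \<nu> \<and> log_orbit \<epsilon> {0..t} w v)"
    and "log_orbit \<epsilon> {0..t} u v" "u 0 = fst \<nu>" "v 0 = snd \<nu>" "0 \<le> t"
  shows "flow D F \<nu> t = u t"
  unfolding flow_def assms(1)
proof (rule the_equality)
  show "\<exists>w. (\<exists>v. w 0 = fst \<nu> \<and> v 0 = snd \<nu> \<and> log_orbit \<epsilon> {0..t} w v) \<and> w t = u t"
    using assms by blast
  fix x assume "\<exists>w. (\<exists>v. w 0 = fst \<nu> \<and> v 0 = snd \<nu> \<and> log_orbit \<epsilon> {0..t} w v) \<and> w t = x"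
  then obtain w v' where "w 0 = fst \<nu>" "v' 0 = snd \<nu>" "log_orbit \<epsilon> {0..t} w v'" "w t = x" by blast
  then show "x = u t" using log_orbit_unique[OF assms(2), of w v' t] assms(3-5) by simp
qed

lemma smoothed_flow_eq:
  assumes "0 < \<epsilon>" "log_orbit \<epsilon> {0..} u v" "u 0 = fst \<nu>" "v 0 = snd \<nu>" "0 \<le> t"
  shows "smoothed_flow (\<lambda>x. - ln x) \<epsilon> \<nu> t = u t"
  by (rule flow_eqI[OF smoothed_solves_iff[OF assms(1)] log_orbit_subset[OF assms(2)] assms(3-5)]) auto

lemma smoothed_exists_log:
  assumes "0 < \<epsilon>"
  shows "smoothed_exists (\<lambda>x. - ln x) \<epsilon> \<nu> t"
proof -
  obtain u v where uv: "log_orbit \<epsilon> {0..} u v" "u 0 = fst \<nu>" "v 0 = snd \<nu>"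
    using log_orbit_exists[OF assms, of \<nu>] by blast
  have "log_orbit \<epsilon> {0..t} u v" by (rule log_orbit_subset[OF uv(1)]) auto
  then show ?thesis
    unfolding exists_until_def smoothed_solves_iff[OF assms] using uv(2,3) by blast
qed

text \<open>The orbit colliding later agrees with the other one up to the earlier collision, so by
  continuity it would sit at the origin then, where an orbit with parameter 0 cannot be.\<close>

lemma log_collision_time_unique:
  assumes "log_collision u v T" "log_collision u' v' T'" "u' 0 = u 0" "v' 0 = v 0"
  shows "T = T'"
proof -
  have less: "\<not> T < T'" if "log_collision u v T" "log_collision u' v' T'" "u' 0 = u 0" "v' 0 = v 0"
    for u v u' v' :: "real \<Rightarrow> 'a" and T T'
  proof
    assume "T < T'"
    interpret A: log_collision u v T by fact
    interpret B: log_collision u' v' T' by fact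
    have T: "T \<in> {0..<T'}" using A.T \<open>T < T'\<close> by simp
    have "u' t = u t" if "t \<in> {0..<T}" for t
    proof -
      have "log_orbit 0 {0..t} u v" by (rule log_orbit_subset[OF A.orb]) (use that in auto)
      moreover have "log_orbit 0 {0..t} u' v'" by (rule log_orbit_subset[OF B.orb]) (use that \<open>T < T'\<close> in auto)
      ultimately have "u' t = u t \<and> v' t = v t"
        using \<open>u' 0 = u 0\<close> \<open>v' 0 = v 0\<close> that by (intro log_orbit_unique) auto
      then show ?thesis by simp
    qed
    then have ev: "\<forall>\<^sub>F t in at_left T. u t = u' t" using A.near_T by (auto elim: eventually_mono)
    have "(u' \<longlongrightarrow> u' T) (at T within {0..<T'})"
      using log_orbit_continuous(1)[OF B.orb] T by (simp add: continuous_on)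
    moreover have "at_left T \<le> at T within {0..<T'}"
    proof -
      have "at_left T = at T within {0..<T}"
        by (rule at_within_nhd[of T "{0<..}"]) (use A.T in auto)
      also have "\<dots> \<le> at T within {0..<T'}" by (rule at_le) (use \<open>T < T'\<close> in auto)
      finally show ?thesis .
    qed
    ultimately have "(u' \<longlongrightarrow> u' T) (at_left T)" by (rule filterlim_mono[OF _ order_refl])
    moreover have "(u' \<longlongrightarrow> 0) (at_left T)" by (rule Lim_transform_eventually[OF A.lim ev])
    ultimately have "u' T = 0" by (rule tendsto_unique[OF trivial_limit_at_left_real])
    then show False using log_orbitD(1)[OF B.orb T] by simp
  qed
  show ?thesis
    using less[OF assms] less[OF assms(2,1) assms(3,4)[symmetric]] by linarith
qed

lemma collides_at_log_iff:
  "collides_at (\<lambda>x. - ln x) \<nu> T \<longleftrightarrow> (\<exists>u v. u 0 = fst \<nu> \<and> v 0 = snd \<nu> \<and> log_collision u v T)"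
  unfolding collides_at_def classical_solves_iff log_collision_def by blast

lemma collision_time_eq:
  assumes "log_collision u v T" "u 0 = fst \<nu>" "v 0 = snd \<nu>"
  shows "collision_time (\<lambda>x. - ln x) \<nu> = T"
  unfolding collision_time_def collides_at_log_iff
proof (rule the_equality)
  show "\<exists>u v. u 0 = fst \<nu> \<and> v 0 = snd \<nu> \<and> log_collision u v T" using assms by blast
  fix T' assume "\<exists>u v. u 0 = fst \<nu> \<and> v 0 = snd \<nu> \<and> log_collision u v T'"
  then obtain u' v' where "u' 0 = fst \<nu>" "v' 0 = snd \<nu>" "log_collision u' v' T'" by blast
  then show "T' = T" using log_collision_time_unique[OF _ assms(1), of u' v' T'] assms(2,3) by simp
qed

section \<open>Convergence along the joint filter and continuity in the initial data\<close>

lemma eventually_joint_filter_pos: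
  "\<forall>\<^sub>F (\<epsilon>, \<mu>) in joint_filter \<nu>. (0 :: real) < \<epsilon>"
  unfolding joint_filter_def by (simp add: eventually_at_filter case_prod_beta mem_Times_iff)

lemma joint_filter_not_bot: "joint_filter \<nu> \<noteq> bot"
proof -
  have "(0, \<nu>) islimpt {0 :: real<..} \<times> (UNIV :: (plane \<times> plane) set)"
    unfolding islimpt_approachable
  proof (intro allI impI)
    fix r :: real assume "0 < r"
    show "\<exists>x\<in>{0 :: real<..} \<times> UNIV. x \<noteq> (0, \<nu>) \<and> dist x (0, \<nu>) < r"
    proof (rule bexI[of _ "(r / 2, \<nu>)"])
      show "(r / 2, \<nu>) \<noteq> (0, \<nu>) \<and> dist (r / 2, \<nu>) (0, \<nu>) < r"
        using \<open>0 < r\<close> by (simp add: dist_Pair_Pair dist_real_def)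
    qed (use \<open>0 < r\<close> in simp)
  qed
  then show ?thesis by (simp add: joint_filter_def trivial_limit_within)
qed

text \<open>Closeness in the product metric controls the parameter and both components of the data;
  since the flow value is attained by a global orbit, a property of all nearby orbits passes to
  it.\<close>

lemma eventually_smoothed_flow:
  assumes "eventually_smoothed {0..} (fst \<nu>) (snd \<nu>) (\<lambda>U W. P (U t))" "0 \<le> t"
  shows "\<forall>\<^sub>F (\<epsilon>, \<mu>) in joint_filter \<nu>. P (smoothed_flow (\<lambda>x. - ln x) \<epsilon> \<mu> t)"
proof -
  from assms(1) obtain d where d: "0 < d" "\<forall>\<epsilon> U W. \<bar>\<epsilon>\<bar> < d \<longrightarrow> log_orbit \<epsilon> {0..} U W \<longrightarrow>
      dist (U 0) (fst \<nu>) < d \<longrightarrow> dist (W 0) (snd \<nu>) < d \<longrightarrow> P (U t)"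
    unfolding eventually_smoothed_def by (elim exE conjE)
  have "P (smoothed_flow (\<lambda>x. - ln x) \<epsilon> \<mu> t)" if \<epsilon>: "0 < \<epsilon>" and close: "dist (\<epsilon>, \<mu>) (0, \<nu>) < d" for \<epsilon> \<mu>
  proof -
    have "\<bar>\<epsilon>\<bar> < d" "dist \<mu> \<nu> < d"
      using dist_fst_le[of "(\<epsilon>, \<mu>)" "(0, \<nu>)"] dist_snd_le[of "(\<epsilon>, \<mu>)" "(0, \<nu>)"] close by (auto simp: dist_real_def)
    moreover from this(2) have "dist (fst \<mu>) (fst \<nu>) < d" "dist (snd \<mu>) (snd \<nu>) < d"
      using dist_fst_le[of \<mu> \<nu>] dist_snd_le[of \<mu> \<nu>] by auto
    moreover obtain U W where "log_orbit \<epsilon> {0..} U W" "U 0 = fst \<mu>" "W 0 = snd \<mu>"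
      using log_orbit_exists[OF \<epsilon>, of \<mu>] by blast
    ultimately show ?thesis
      using d(2)[THEN spec, THEN spec, THEN spec, THEN mp, THEN mp, THEN mp, THEN mp, of \<epsilon> U W]
        smoothed_flow_eq[OF \<epsilon> _ _ _ \<open>0 \<le> t\<close>, of U W \<mu>] by simp
  qed
  then show ?thesis
    unfolding joint_filter_def eventually_at using d(1) by (intro exI[of _ d]) auto
qed

lemma tendsto_smoothed_flow:
  assumes "\<And>\<eta>. 0 < \<eta> \<Longrightarrow> eventually_smoothed {0..} (fst \<nu>) (snd \<nu>) (\<lambda>U W. dist (U t) x < \<eta>)" "0 \<le> t"
  shows "((\<lambda>(\<epsilon>, \<mu>). smoothed_flow (\<lambda>x. - ln x) \<epsilon> \<mu> t) \<longlongrightarrow> x) (joint_filter \<nu>)"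
proof (rule tendstoI)
  fix \<eta> :: real assume "0 < \<eta>"
  from eventually_smoothed_flow[OF assms(1)[OF this] assms(2)]
  show "\<forall>\<^sub>F z in joint_filter \<nu>. dist (case z of (\<epsilon>, \<mu>) \<Rightarrow> smoothed_flow (\<lambda>x. - ln x) \<epsilon> \<mu> t) x < \<eta>"
    by (rule eventually_mono) auto
qed

lemma collision_joint_limit:
  assumes "\<nu> \<in> collision_set (\<lambda>x. - ln x)" "0 \<le> t" "t \<le> 2 * collision_time (\<lambda>x. - ln x) \<nu>"
  shows "\<exists>x. ((\<lambda>(\<epsilon>, \<mu>). smoothed_flow (\<lambda>x. - ln x) \<epsilon> \<mu> t) \<longlongrightarrow> x) (joint_filter \<nu>)"
proof -
  obtain u v T where uv: "u 0 = fst \<nu>" "v 0 = snd \<nu>" "log_collision u v T"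
    using assms(1) by (auto simp: collision_set_def collides_at_log_iff)
  interpret log_collision u v T by (rule uv)
  \<comment> \<open>This is where the dimension of the plane is used.\<close>
  have "\<exists>a. norm a = 1 \<and> a \<bullet> w = 0" for w :: plane
  proof -
    obtain a :: plane where "a \<noteq> 0" "orthogonal w a"
      using orthogonal_to_vector_exists[of w] by auto
    then show ?thesis
      by (intro exI[of _ "a /\<^sub>R norm a"]) (simp add: orthogonal_def inner_commute)
  qed
  moreover have "t \<in> {0..2 * T}" using assms(2,3) collision_time_eq[OF uv(3,1,2)] by simp
  ultimately obtain x where "\<forall>\<eta>>0. eventually_smoothed {0..} (u 0) (v 0) (\<lambda>U W. dist (U t) x < \<eta>)"
    using smoothing_limit by blast
  then show ?thesis using uv assms(2) by (intro exI[of _ x] tendsto_smoothed_flow) auto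
qed

text \<open>Both branches of the regularized flow are the same joint limit, so continuity needs no
  comparison of collision data with nearby regular data.\<close>

lemma regularized_flow_joint_limit:
  assumes "\<nu> \<in> regularized_domain (\<lambda>x. - ln x) t" "0 \<le> t"
  shows "((\<lambda>(\<epsilon>, \<mu>). smoothed_flow (\<lambda>x. - ln x) \<epsilon> \<mu> t) \<longlongrightarrow> regularized_flow (\<lambda>x. - ln x) \<nu> t) (joint_filter \<nu>)"
proof (cases "\<nu> \<in> collision_set (\<lambda>x. - ln x)")
  case True
  then obtain x where x: "((\<lambda>(\<epsilon>, \<mu>). smoothed_flow (\<lambda>x. - ln x) \<epsilon> \<mu> t) \<longlongrightarrow> x) (joint_filter \<nu>)"
    using collision_joint_limit[OF True assms(2)] assms(1) by (auto simp: regularized_domain_def)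
  have "limit_path (\<lambda>x. - ln x) \<nu> t = x"
    unfolding limit_path_def by (rule tendsto_Lim[OF joint_filter_not_bot x])
  with x True show ?thesis by (simp add: regularized_flow_def)
next
  case False
  then have "classical_exists (\<lambda>x. - ln x) \<nu> t" using assms(1) by (simp add: regularized_domain_def)
  then obtain u v where uv: "u 0 = fst \<nu>" "v 0 = snd \<nu>" "log_orbit 0 {0..t} u v"
    unfolding exists_until_def classical_solves_iff by blast
  have "classical_flow (\<lambda>x. - ln x) \<nu> t = u t"
    by (rule flow_eqI[OF classical_solves_iff uv(3,1,2) assms(2)])
  moreover have "((\<lambda>(\<epsilon>, \<mu>). smoothed_flow (\<lambda>x. - ln x) \<epsilon> \<mu> t) \<longlongrightarrow> u t) (joint_filter \<nu>)"
  proof (rule tendsto_smoothed_flow[OF _ assms(2)])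
    fix \<eta> :: real assume "0 < \<eta>"
    from log_orbit_eventually_close[OF uv(3) assms(2) this]
    show "eventually_smoothed {0..} (fst \<nu>) (snd \<nu>) (\<lambda>U W. dist (U t) (u t) < \<eta>)"
      unfolding uv(1,2)[symmetric]
      by (rule eventually_smoothed_mono) (use assms(2) in auto)
  qed
  ultimately show ?thesis using False by (simp add: regularized_flow_def)
qed

text \<open>A limit that is joint in the parameter and the point is automatically continuous in the point,
  since the values of \<open>g\<close> near \<open>(0, \<nu>)\<close> also determine \<open>f\<close> at points near \<open>\<nu>\<close>.\<close>

lemma continuous_on_joint_limit:
  fixes f :: "plane \<times> plane \<Rightarrow> 'b::metric_space"
  assumes lim: "\<And>\<nu>. \<nu> \<in> D \<Longrightarrow> (g \<longlongrightarrow> f \<nu>) (joint_filter \<nu>)"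
  shows "continuous_on D f"
  unfolding continuous_on_iff
proof (intro ballI allI impI)
  fix \<nu> and r :: real assume \<nu>: "\<nu> \<in> D" and r: "0 < r"
  \<comment> \<open>Half of \<open>r\<close>, because the limit taken at a neighbouring point
    preserves only the weak inequality.\<close>
  have "\<forall>\<^sub>F z in joint_filter \<nu>. dist (g z) (f \<nu>) < r / 2" using lim[OF \<nu>] r by (intro tendstoD) auto
  then obtain d where d: "0 < d"
    "\<And>z. z \<in> {0<..} \<times> UNIV \<Longrightarrow> z \<noteq> (0, \<nu>) \<Longrightarrow> dist z (0, \<nu>) < d \<Longrightarrow> dist (g z) (f \<nu>) < r / 2"
    unfolding joint_filter_def eventually_at by blast
  have "dist (f \<nu>') (f \<nu>) < r" if \<nu>': "\<nu>' \<in> D" "dist \<nu>' \<nu> < d" for \<nu>'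
  proof -
    have "((\<lambda>z. dist (g z) (f \<nu>)) \<longlongrightarrow> dist (f \<nu>') (f \<nu>)) (joint_filter \<nu>')"
      by (intro tendsto_dist lim \<nu>' tendsto_const)
    moreover have "\<forall>\<^sub>F z in joint_filter \<nu>'. dist (g z) (f \<nu>) \<le> r / 2"
    proof -
      \<comment> \<open>The ball around \<open>(0, \<nu>')\<close> lies in the given ball around
        \<open>(0, \<nu>)\<close>, and a positive first component keeps \<open>z\<close> off the
        centre.\<close>
      have "dist (g z) (f \<nu>) \<le> r / 2" if z: "z \<in> {0<..} \<times> UNIV" "dist z (0, \<nu>') < d - dist \<nu>' \<nu>" for z
      proof -
        have "dist z (0, \<nu>) \<le> dist z (0, \<nu>') + dist (0 :: real, \<nu>') (0, \<nu>)" by (rule dist_triangle)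
        also have "dist (0 :: real, \<nu>') (0, \<nu>) = dist \<nu>' \<nu>" by (simp add: dist_Pair_Pair)
        finally have "dist z (0, \<nu>) < d" using z(2) by simp
        then have "dist (g z) (f \<nu>) < r / 2" using z(1) by (intro d(2)) auto
        then show ?thesis by simp
      qed
      then show ?thesis
        unfolding joint_filter_def eventually_at using \<nu>'(2) by (intro exI[of _ "d - dist \<nu>' \<nu>"]) auto
    qed
    ultimately have "dist (f \<nu>') (f \<nu>) \<le> r / 2"
      by (rule tendsto_upperbound[OF _ _ joint_filter_not_bot])
    then show ?thesis using r by simp
  qed
  then show "\<exists>d>0. \<forall>\<nu>'\<in>D. dist \<nu>' \<nu> < d \<longrightarrow> dist (f \<nu>') (f \<nu>) < r" using d(1) by blast
qed

theorem corollary1p1: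
  shows "globally_strongly_regularizable (\<lambda>x::real. - ln x)"
  unfolding globally_strongly_regularizable_def
proof (intro conjI ballI allI impI)
  fix \<nu> t assume "\<nu> \<in> collision_set (\<lambda>x::real. - ln x)" "t \<in> {0..2 * collision_time (\<lambda>x. - ln x) \<nu>}"
  then show "\<exists>x. ((\<lambda>(\<epsilon>, \<mu>). smoothed_flow (\<lambda>x. - ln x) \<epsilon> \<mu> t) \<longlongrightarrow> x) (joint_filter \<nu>)"
    by (intro collision_joint_limit) auto
  show "\<forall>\<^sub>F (\<epsilon>, \<mu>) in joint_filter \<nu>. smoothed_exists (\<lambda>x. - ln x) \<epsilon> \<mu> t"
    using eventually_joint_filter_pos by (rule eventually_mono) (auto intro: smoothed_exists_log)
next
  fix t :: real assume "0 \<le> t"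
  show "continuous_on (regularized_domain (\<lambda>x. - ln x) t) (\<lambda>\<nu>. regularized_flow (\<lambda>x. - ln x) \<nu> t)"
    by (rule continuous_on_joint_limit[OF regularized_flow_joint_limit[OF _ \<open>0 \<le> t\<close>]])
qed

end
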